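(* Let $G$ be a (finite, simple, undirected) even balanced co-chain graph. Then $\tau(G) \leq 2\mu(G)$.
   Context: A triangle packing of a graph $G$ is a family of pairwise edge-disjoint triangles of $G$; $\mu(G)$ denotes the maximum size of a triangle packing in $G$. A triangle hitting of $G$ is a set of edges intersecting every triangle of $G$; $\tau(G)$ denotes the minimum size of a triangle hitting in $G$. For a vertex $v$, $N[v]$ denotes its closed neighbourhood. A graph $G$ is a co-chain graph if its vertex set can be partitioned into two sets $K_1$ and $K_2$ such that $G[K_1]$ and $G[K_2]$ are cliques and there are orderings $c_1,\dots,c_n$ of $K_1$ and $d_1,\dots,d_m$ of $K_2$ with $N[c_{i+1}]\subseteq N[c_i]$ for all $1\le i<n$ and $N[d_i]\subseteq N[d_{i+1}]$ for all $1\le i<m$; $(K_1,K_2)$ is then called a co-chain representation. $G$ is an even balanced co-chain graph if it has such a co-chain representation in which additionally $|K_1|=|K_2|$ and this common size is divisible by $4$. *)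

theory Defs
  imports "HOL-Library.Ramsey"
begin

text \<open>An undirected graph is given by a vertex set and a set of two-element sets of vertices.\<close>

definition finite_simple_graph :: "'a set \<Rightarrow> 'a set set \<Rightarrow> bool" where
  "finite_simple_graph V E \<longleftrightarrow> finite V \<and> E \<subseteq> [V]\<^bsup>2\<^esup>"

definition closed_nbhd :: "'a set set \<Rightarrow> 'a \<Rightarrow> 'a set" where
  "closed_nbhd E v = insert v {w. {v, w} \<in> E}"

text \<open>A triangle is identified with its set \<open>T\<close> of three vertices; its edges are \<open>[T]\<^bsup>2\<^esup>\<close>.\<close>

definition triangles :: "'a set \<Rightarrow> 'a set set \<Rightarrow> 'a set set" where
  "triangles V E = {T \<in> [V]\<^bsup>3\<^esup>. [T]\<^bsup>2\<^esup> \<subseteq> E}"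

definition triangle_packing :: "'a set \<Rightarrow> 'a set set \<Rightarrow> 'a set set \<Rightarrow> bool" where
  "triangle_packing V E P \<longleftrightarrow>
     P \<subseteq> triangles V E \<and> pairwise (\<lambda>S T. disjnt ([S]\<^bsup>2\<^esup>) ([T]\<^bsup>2\<^esup>)) P"

definition triangle_hitting :: "'a set \<Rightarrow> 'a set set \<Rightarrow> 'a set set \<Rightarrow> bool" where
  "triangle_hitting V E F \<longleftrightarrow> F \<subseteq> E \<and> (\<forall>T \<in> triangles V E. F \<inter> [T]\<^bsup>2\<^esup> \<noteq> {})"

text \<open>For a finite simple graph both sets of cardinalities below are finite and nonempty
  (\<open>{}\<close> is a packing and \<open>E\<close> is a hitting), so the maximum and the minimum are attained.\<close>

definition packing_number :: "'a set \<Rightarrow> 'a set set \<Rightarrow> nat" ("\<mu>") where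
  "\<mu> V E = Max (card ` {P. triangle_packing V E P})"

definition hitting_number :: "'a set \<Rightarrow> 'a set set \<Rightarrow> nat" ("\<tau>") where
  "\<tau> V E = Min (card ` {F. triangle_hitting V E F})"

text \<open>The orderings of the two cliques are duplicate-free lists, indexed from \<open>0\<close>. Closed
  neighbourhoods decrease along the first and increase along the second.\<close>

definition cochain_representation ::
  "'a set \<Rightarrow> 'a set set \<Rightarrow> 'a set \<Rightarrow> 'a set \<Rightarrow> bool" where
  "cochain_representation V E K1 K2 \<longleftrightarrow>
     K1 \<union> K2 = V \<and> K1 \<inter> K2 = {} \<and> clique K1 E \<and> clique K2 E \<and>
     (\<exists>cs. distinct cs \<and> set cs = K1 \<and>
        (\<forall>i. Suc i < length cs \<longrightarrow> closed_nbhd E (cs ! Suc i) \<subseteq> closed_nbhd E (cs ! i))) \<and>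
     (\<exists>ds. distinct ds \<and> set ds = K2 \<and>
        (\<forall>i. Suc i < length ds \<longrightarrow> closed_nbhd E (ds ! i) \<subseteq> closed_nbhd E (ds ! Suc i)))"

definition even_balanced_cochain_graph :: "'a set \<Rightarrow> 'a set set \<Rightarrow> bool" where
  "even_balanced_cochain_graph V E \<longleftrightarrow> finite_simple_graph V E \<and>
     (\<exists>K1 K2. cochain_representation V E K1 K2 \<and> card K1 = card K2 \<and> 4 dvd card K1)"

end

theory Submission
  imports Defs
begin

text \<open>Let both cliques have \<open>2m\<close> vertices, \<open>m\<close> even, ordered so that neighbourhoods decrease, and cut
  each into its first half (\<open>A\<^sub>1\<close>, \<open>B\<^sub>1\<close>) and its second half (\<open>A\<^sub>2\<close>, \<open>B\<^sub>2\<close>).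
  Hitting sets are the uncut edges of vertex bipartitions: a balanced cut costs \<open>2m(m - 1)\<close> edges
  inside the cliques plus the uncut cross edges. Packings join the colour classes of
  1-factorizations of cliques to distinct apex vertices. A 1-factorization of \<open>A\<^sub>2\<close> with apexes in
  \<open>A\<^sub>1\<close>, and likewise for \<open>B\<close>, yields \<open>m(m - 1)\<close> triangles, half the basic cost, and leaves one
  vertex of \<open>A\<^sub>1\<close> and one of \<open>B\<^sub>1\<close> unused as apex. It remains to pay for half of the uncut cross
  edges by triangles with two cross edges. If \<open>A\<^sub>2\<close> and \<open>B\<^sub>2\<close> are not joined, only the number \<open>p\<close> of
  vertices of \<open>A\<^sub>1\<close> with a neighbour in \<open>B\<^sub>2\<close> and the symmetric number \<open>q\<close> matter; otherwise the
  numbers of vertices of \<open>A\<^sub>2\<close> and \<open>B\<^sub>2\<close> that have neighbours in the opposite second half do. A triangle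
  through an unused apex compensates the rounding losses.\<close>

subsection \<open>Edge-disjoint triangles\<close>

text \<open>For disjoint \<open>W\<close> and \<open>S\<close> this is the edge set of the complete
  bipartite graph between them; a common element would contribute a singleton.\<close>

definition bip :: "'a set \<Rightarrow> 'a set \<Rightarrow> 'a set set" where
  "bip W S = {{w, x} | w x. w \<in> W \<and> x \<in> S}"

text \<open>A lower bound instead of an exact count makes the notion monotone in \<open>F\<close>
  and antitone in \<open>k\<close>. No vertex set occurs, because edge sets alone decide whether two
  packings can be merged.\<close>

definition packs :: "'a set set \<Rightarrow> nat \<Rightarrow> bool" where
  "packs F k \<longleftrightarrow> (\<exists>P. finite P \<and> k \<le> card P \<and> (\<forall>T\<in>P. card T = 3 \<and> [T]\<^bsup>2\<^esup> \<subseteq> F) \<and>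
     pairwise (\<lambda>S T. disjnt ([S]\<^bsup>2\<^esup>) ([T]\<^bsup>2\<^esup>)) P)"

lemma packs_mono: "packs F k \<Longrightarrow> F \<subseteq> G \<Longrightarrow> l \<le> k \<Longrightarrow> packs G l"
  unfolding packs_def by (meson order_trans)

lemma nsets_2_nonempty: "card T = 3 \<Longrightarrow> [T]\<^bsup>2\<^esup> \<noteq> {}"
  unfolding nsets_eq_empty_iff by simp

lemma packs_Un:
  assumes "packs F k" "packs G l" "F \<inter> G = {}"
  shows "packs (F \<union> G) (k + l)"
proof -
  obtain P where P: "finite P" "k \<le> card P" "\<forall>T\<in>P. card T = 3 \<and> [T]\<^bsup>2\<^esup> \<subseteq> F"
      "pairwise (\<lambda>S T. disjnt ([S]\<^bsup>2\<^esup>) ([T]\<^bsup>2\<^esup>)) P"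
    using assms(1) unfolding packs_def by blast
  obtain Q where Q: "finite Q" "l \<le> card Q" "\<forall>T\<in>Q. card T = 3 \<and> [T]\<^bsup>2\<^esup> \<subseteq> G"
      "pairwise (\<lambda>S T. disjnt ([S]\<^bsup>2\<^esup>) ([T]\<^bsup>2\<^esup>)) Q"
    using assms(2) unfolding packs_def by blast
  have cross: "disjnt ([S]\<^bsup>2\<^esup>) ([T]\<^bsup>2\<^esup>)" if "S \<in> P" "T \<in> Q" for S T
    using P(3) Q(3) assms(3) that by (meson disjnt_def disjnt_subset1 disjnt_subset2)
  \<comment> \<open>A common member would have an edge lying in both \<open>F\<close> and
    \<open>G\<close>.\<close>
  have "T \<notin> Q" if "T \<in> P" for T
    using cross[of T T] P(3) nsets_2_nonempty[of T] that by auto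
  then have "P \<inter> Q = {}" by auto
  then have "k + l \<le> card (P \<union> Q)"
    using P(1,2) Q(1,2) by (simp add: card_Un_disjoint)
  moreover have "pairwise (\<lambda>S T. disjnt ([S]\<^bsup>2\<^esup>) ([T]\<^bsup>2\<^esup>)) (P \<union> Q)"
    using P(4) Q(4) cross unfolding pairwise_def by (auto simp: disjnt_sym)
  ultimately show ?thesis
    unfolding packs_def using P(1,3) Q(1,3) by (intro exI[of _ "P \<union> Q"]) auto
qed

lemma packs_triangle: "card T = 3 \<Longrightarrow> packs ([T]\<^bsup>2\<^esup>) 1"
  unfolding packs_def by (intro exI[of _ "{T}"]) auto

lemma clq_clq: "S \<inter> T = {} \<Longrightarrow> [S]\<^bsup>2\<^esup> \<inter> [T]\<^bsup>2\<^esup> = {}"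
  by (auto simp: nsets_2_eq doubleton_eq_iff)

lemma clq_bip: "S \<inter> W = {} \<or> S \<inter> T = {} \<Longrightarrow> [S]\<^bsup>2\<^esup> \<inter> bip W T = {}"
  by (auto simp: nsets_2_eq bip_def doubleton_eq_iff)

lemma bip_clq: "S \<inter> W = {} \<or> S \<inter> T = {} \<Longrightarrow> bip W T \<inter> [S]\<^bsup>2\<^esup> = {}"
  using clq_bip by blast

lemma bip_bip:
  "W \<inter> W' = {} \<or> S \<inter> S' = {} \<Longrightarrow> W \<inter> S' = {} \<or> S \<inter> W' = {} \<Longrightarrow> bip W S \<inter> bip W' S' = {}"
  unfolding bip_def by (auto simp: doubleton_eq_iff)

text \<open>Each edge of \<open>D\<close> becomes a triangle with the apex of its colour. Two such
  triangles could share only an edge at an apex; injectivity of \<open>w\<close> then yields equal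
  colours at a common vertex, which properness forbids.\<close>

lemma packs_apex:
  fixes col :: "'a set \<Rightarrow> nat"
  assumes fin: "finite D" and D: "D \<subseteq> [S]\<^bsup>2\<^esup>"
    and proper: "\<And>e e'. e \<in> D \<Longrightarrow> e' \<in> D \<Longrightarrow> col e = col e' \<Longrightarrow> e \<inter> e' \<noteq> {} \<Longrightarrow> e = e'"
    and w: "inj_on w (col ` D)" "w ` col ` D \<inter> S = {}"
  shows "packs (D \<union> {{w (col e), x} | e x. e \<in> D \<and> x \<in> e}) (card D)"
proof -
  define tri where "tri e = insert (w (col e)) e" for e
  have sub: "e \<subseteq> S" "finite e" "card e = 2" "w (col e) \<notin> S" if "e \<in> D" for e
    using that D w(2) by (force simp: nsets_def)+
  \<comment> \<open>Apexes lie outside \<open>S\<close>, so the base edge is recovered from its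
    triangle.\<close>
  have trace: "tri e \<inter> S = e" if "e \<in> D" for e
    using sub[OF that] by (auto simp: tri_def)
  have inj: "inj_on tri D"
    using trace by (metis inj_onI)
  have edges: "[tri e]\<^bsup>2\<^esup> \<subseteq> insert e {{w (col e), x} | x. x \<in> e}" if "e \<in> D" for e
  proof -
    obtain x y where "e = {x, y}" using sub(3)[OF \<open>e \<in> D\<close>] by (auto simp: card_2_iff)
    then show ?thesis by (auto simp: tri_def nsets_2_eq)
  qed
  have "disjnt ([tri e]\<^bsup>2\<^esup>) ([tri e']\<^bsup>2\<^esup>)" if e: "e \<in> D" and e': "e' \<in> D" and "e \<noteq> e'" for e e'
  proof (rule ccontr)
    assume "\<not> ?thesis"
    then obtain d where d: "d \<in> [tri e]\<^bsup>2\<^esup>" "d \<in> [tri e']\<^bsup>2\<^esup>"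
      by (auto simp: disjnt_def)
    have 1: "d = e \<or> (\<exists>x\<in>e. d = {w (col e), x})" using edges[OF e] d(1) by auto
    have 2: "d = e' \<or> (\<exists>x\<in>e'. d = {w (col e'), x})" using edges[OF e'] d(2) by auto
    note s = sub[OF e] sub[OF e']
    have "d \<noteq> e" "d \<noteq> e'" using 1 2 s \<open>e \<noteq> e'\<close> by auto
    then obtain x x' where "x \<in> e" "x' \<in> e'" "{w (col e), x} = {w (col e'), x'}"
      using 1 2 by metis
    then have "w (col e) = w (col e')" "x = x'" using s by (auto simp: doubleton_eq_iff)
    then have "col e = col e'" using w(1) e e' by (auto dest: inj_onD)
    then show False using proper[OF e e'] \<open>e \<noteq> e'\<close> \<open>x \<in> e\<close> \<open>x' \<in> e'\<close> \<open>x = x'\<close> by blast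
  qed
  then have "pairwise (\<lambda>S T. disjnt ([S]\<^bsup>2\<^esup>) ([T]\<^bsup>2\<^esup>)) (tri ` D)"
    unfolding pairwise_def by auto
  moreover have "card (tri e) = 3" if "e \<in> D" for e
    using sub[OF that] by (auto simp: tri_def card_insert_if)
  moreover have "[tri e]\<^bsup>2\<^esup> \<subseteq> D \<union> {{w (col e), x} | e x. e \<in> D \<and> x \<in> e}" if "e \<in> D" for e
    using edges[OF that] that by blast
  ultimately show ?thesis
    unfolding packs_def using fin inj by (intro exI[of _ "tri ` D"]) (auto simp: card_image)
qed

subsection \<open>Proper edge colourings of complete graphs\<close>

definition proper_col :: "'a set \<Rightarrow> nat \<Rightarrow> ('a set \<Rightarrow> nat) \<Rightarrow> bool" where
  "proper_col S k col \<longleftrightarrow> (\<forall>e \<in> [S]\<^bsup>2\<^esup>. col e < k) \<and>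
     (\<forall>e \<in> [S]\<^bsup>2\<^esup>. \<forall>e' \<in> [S]\<^bsup>2\<^esup>. col e = col e' \<longrightarrow> e \<inter> e' \<noteq> {} \<longrightarrow> e = e')"

lemma proper_colI:
  assumes "\<And>x y. x \<in> S \<Longrightarrow> y \<in> S \<Longrightarrow> x \<noteq> y \<Longrightarrow> col {x, y} < k"
    and "\<And>x y z. x \<in> S \<Longrightarrow> y \<in> S \<Longrightarrow> z \<in> S \<Longrightarrow> x \<noteq> y \<Longrightarrow> x \<noteq> z \<Longrightarrow> col {x, y} = col {x, z} \<Longrightarrow> y = z"
  shows "proper_col S k col"
  unfolding proper_col_def
proof (intro conjI ballI impI)
  fix e assume "e \<in> [S]\<^bsup>2\<^esup>"
  then show "col e < k" using assms(1) by (auto elim!: nsets2_E)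
next
  fix e e' assume e: "e \<in> [S]\<^bsup>2\<^esup>" "e' \<in> [S]\<^bsup>2\<^esup>" and c: "col e = col e'" and "e \<inter> e' \<noteq> {}"
  then obtain x where x: "x \<in> e" "x \<in> e'" by blast
  obtain y where y: "e = {x, y}" "y \<in> S" "x \<noteq> y" "x \<in> S"
    using e(1) x(1) by (auto elim!: nsets2_E)
  obtain z where z: "e' = {x, z}" "z \<in> S" "x \<noteq> z"
    using e(2) x(2) by (auto elim!: nsets2_E)
  show "e = e'" using assms(2)[of x y z] y z c by auto
qed

lemma proper_col_vimage:
  assumes "proper_col S k col" and g: "inj_on g T" "g ` T \<subseteq> S"
  shows "proper_col T k (\<lambda>e. col (g ` e))"
proof (rule proper_colI)
  fix x y assume "x \<in> T" "y \<in> T" "x \<noteq> y"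
  then have "g ` {x, y} \<in> [S]\<^bsup>2\<^esup>" using g by (auto dest: inj_onD)
  then show "col (g ` {x, y}) < k" using assms(1) by (auto simp: proper_col_def)
next
  fix x y z assume *: "x \<in> T" "y \<in> T" "z \<in> T" "x \<noteq> y" "x \<noteq> z" and c: "col (g ` {x, y}) = col (g ` {x, z})"
  then have "g ` {x, y} \<in> [S]\<^bsup>2\<^esup>" "g ` {x, z} \<in> [S]\<^bsup>2\<^esup>" "g ` {x, y} \<inter> g ` {x, z} \<noteq> {}"
    using g by (auto dest: inj_onD)
  then have "g ` {x, y} = g ` {x, z}" using c assms(1) unfolding proper_col_def by blast
  then show "y = z" using * g(1) by (auto simp: doubleton_eq_iff dest: inj_onD)
qed

lemma mod_add_cancel:
  fixes x y z k :: nat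
  assumes "(x + y) mod k = (x + z) mod k" "y < k" "z < k"
  shows "y = z"
proof -
  have "int (x + y) mod int k = int (x + z) mod int k"
    using assms(1) by (simp only: of_nat_mod[symmetric])
  then have "int y mod int k = int z mod int k" by (simp add: mod_eq_dvd_iff)
  then show ?thesis using assms(2,3) by simp
qed

text \<open>The vertex \<open>s - 1\<close> plays the point at infinity of the usual 1-factorization over
  \<open>\<int>/(s - 1)\<close>. The pairs with sum \<open>s - 1\<close> form one class, so a class can be arranged to match
  any prescribed subset of the vertices, up to one vertex if its size is odd.\<close>

lemma one_factorization_nat:
  assumes "even s"
  shows "\<exists>col. proper_col {..<s} (s - 1) col \<and> (\<forall>x<s. x \<noteq> s - 1 - x \<longrightarrow> col {x, s - 1 - x} = 0)"
proof -
  define r where "r = s - 1"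
  \<comment> \<open>At the point at infinity \<open>r\<close> the term \<open>\<Sum>e - r\<close> is
    the other end x. The edge gets the colour of x + x, which no other edge at x has.\<close>
  define col where "col e = (if r \<in> e then 2 * (\<Sum>e - r) else \<Sum>e) mod r" for e :: "nat set"
  have c1: "col {x, y} = (x + y) mod r" if "x < r" "y < r" "x \<noteq> y" for x y
    using that by (auto simp: col_def)
  have c2: "col {x, r} = (x + x) mod r" "col {r, x} = (x + x) mod r" if "x < r" for x
    using that by (auto simp: col_def mult_2)
  have "proper_col {..<s} r col"
  proof (rule proper_colI)
    fix x y assume "x \<in> {..<s}" "y \<in> {..<s}" "x \<noteq> y"
    then have "r > 0" by (auto simp: r_def)
    then show "col {x, y} < r" by (auto simp: col_def)
  next
    fix x y z assume *: "x \<in> {..<s}" "y \<in> {..<s}" "z \<in> {..<s}" "x \<noteq> y" "x \<noteq> z" "col {x, y} = col {x, z}"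
    have odd: "odd r" using assms *(1) by (auto simp: r_def)
    have lt: "v < r \<or> v = r" if "v \<in> {..<s}" for v using that by (auto simp: r_def)
    consider "x = r" "y < r" "z < r" | "x < r" "y = r" "z = r" | "x < r" "y < r" "z = r"
      | "x < r" "y = r" "z < r" | "x < r" "y < r" "z < r"
      using lt *(1-5) by blast
    then show "y = z"
    proof cases
      case 1
      then have "(2 * y) mod r = (2 * z) mod r" using *(6) c2 by (simp add: mult_2)
      then have "int (2 * y) mod int r = int (2 * z) mod int r" by (simp only: of_nat_mod[symmetric])
      then have "int r dvd 2 * (int y - int z)"
        by (simp add: mod_eq_dvd_iff right_diff_distrib)
      \<comment> \<open>Evenness of \<open>s\<close> enters here: \<open>r\<close> is odd, so 2 is
        invertible modulo \<open>r\<close>.\<close>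
      then have "int r dvd int y - int z"
        using odd by (subst (asm) coprime_dvd_mult_right_iff) auto
      then have "int y mod int r = int z mod int r" by (simp add: mod_eq_dvd_iff)
      then show ?thesis using 1 by simp
    next
      case 2
      then show ?thesis by simp
    next
      case 3
      then have "(x + y) mod r = (x + x) mod r" using *(4,6) c1 c2 by simp
      then show ?thesis using 3 *(4) mod_add_cancel by blast
    next
      case 4
      then have "(x + x) mod r = (x + z) mod r" using *(5,6) c1 c2 by simp
      then show ?thesis using 4 *(5) mod_add_cancel by blast
    next
      case 5
      then have "(x + y) mod r = (x + z) mod r" using *(4,5,6) c1 by simp
      then show ?thesis using 5 mod_add_cancel by blast
    qed
  qed
  moreover have "col {x, s - 1 - x} = 0" if "x < s" "x \<noteq> s - 1 - x" for x
  proof (cases "x = 0 \<or> x = r")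
    case True
    then show ?thesis using that c2[of 0] by (auto simp: r_def)
  next
    case False
    then have "x < r" "r - x < r" using that(1) by (auto simp: r_def)
    then show ?thesis using c1[of x "r - x"] that(2) by (simp add: r_def)
  qed
  ultimately show ?thesis unfolding r_def by blast
qed

text \<open>A colour class is a matching, so its edges cover twice as many vertices as there are
  edges.\<close>

lemma finite_colour_class:
  assumes "finite S" and col: "proper_col S k col"
  shows "card {e \<in> [S]\<^bsup>2\<^esup>. col e = c} \<le> card S div 2"
proof -
  define C where "C = {e \<in> [S]\<^bsup>2\<^esup>. col e = c}"
  have "pairwise disjnt C"
    using col unfolding proper_col_def C_def pairwise_def disjnt_def by simp metis
  moreover have "finite e" "card e = 2" "e \<subseteq> S" if "e \<in> C" for e
    using that by (auto simp: C_def nsets_def)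
  ultimately have "card (\<Union>C) = 2 * card C" "\<Union>C \<subseteq> S"
    by (auto simp: card_Union_disjoint)
  then have "2 * card C \<le> card S"
    using assms(1) by (metis card_mono)
  then show ?thesis by (simp add: C_def)
qed

text \<open>A class has at most half as many edges as there are vertices; with one colour fewer than vertices
  the total count forces every class to be perfect.\<close>

lemma card_colours_ge:
  assumes "finite S" "even (card S)" and col: "proper_col S (card S - 1) col" and K: "K \<subseteq> {..<card S - 1}"
  shows "card K * (card S div 2) \<le> card {e \<in> [S]\<^bsup>2\<^esup>. col e \<in> K}"
proof -
  define n where "n X = card {e \<in> [S]\<^bsup>2\<^esup>. col e \<in> X}" for X
  have fin: "finite ([S]\<^bsup>2\<^esup>)" using assms(1) by (rule finite_imp_finite_nsets)
  have le: "n X \<le> card X * (card S div 2)" if "finite X" for X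
  proof -
    have "{e \<in> [S]\<^bsup>2\<^esup>. col e \<in> X} = (\<Union>c\<in>X. {e \<in> [S]\<^bsup>2\<^esup>. col e = c})" by auto
    then have "n X \<le> (\<Sum>c\<in>X. card {e \<in> [S]\<^bsup>2\<^esup>. col e = c})"
      unfolding n_def using card_UN_le[OF that] by simp
    also have "\<dots> \<le> (\<Sum>c\<in>X. card S div 2)"
      by (intro sum_mono finite_colour_class[OF assms(1) col])
    finally show ?thesis by simp
  qed
  let ?K' = "{..<card S - 1} - K"
  have "{e \<in> [S]\<^bsup>2\<^esup>. col e \<in> K} \<union> {e \<in> [S]\<^bsup>2\<^esup>. col e \<in> ?K'} = [S]\<^bsup>2\<^esup>"
    using col by (auto simp: proper_col_def)
  then have "card ([S]\<^bsup>2\<^esup>) = n K + n ?K'"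
    unfolding n_def using fin by (subst card_Un_disjoint[symmetric]) auto
  moreover have "card ([S]\<^bsup>2\<^esup>) = (card S - 1) * (card S div 2)"
    using assms(2) by (auto simp: card_nsets choose_two elim!: evenE)
  moreover have "card ?K' = card S - 1 - card K"
    using K by (simp add: card_Diff_subset finite_subset)
  moreover have "card K \<le> card S - 1" using K card_mono[of "{..<card S - 1}" K] by simp
  \<comment> \<open>\<open>d\<close> counts the colours outside \<open>K\<close> and avoids
    truncated subtraction.\<close>
  moreover obtain d where "card S - 1 = card K + d"
    using \<open>card K \<le> card S - 1\<close> le_Suc_ex by blast
  ultimately have "card K * (card S div 2) + d * (card S div 2) = n K + n ?K'" "card ?K' = d"
    by (simp_all add: add_mult_distrib)
  then have "n K \<ge> card K * (card S div 2)"
    using le[of ?K'] by simp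
  then show ?thesis by (simp add: n_def)
qed

text \<open>The vertices are relabelled so that \<open>T\<close> occupies labels at both ends of
  \<open>{..<s}\<close>. Class 0 pairs \<open>x\<close> with \<open>s - 1 - x\<close>, so the outer
  labels of \<open>T\<close> are matched among themselves; one vertex of \<open>T\<close> stays
  outside \<open>R\<close> if \<open>card T\<close> is odd.\<close>

lemma one_factorization:
  assumes "finite S" "even (card S)" "T \<subseteq> S"
  obtains col R where "proper_col S (card S - 1) col" "R \<subseteq> T" "card R = 2 * (card T div 2)"
    "card T div 2 \<le> card {e \<in> [R]\<^bsup>2\<^esup>. col e = 0}"
proof -
  define s k h where "s = card S" and "k = card T" and "h = card T div 2"
  have k: "k \<le> s" "2 * h \<le> k" using assms by (auto simp: s_def k_def h_def card_mono)
  obtain col where col: "proper_col {..<s} (s - 1) col" "\<forall>x<s. x \<noteq> s - 1 - x \<longrightarrow> col {x, s - 1 - x} = 0"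
    using one_factorization_nat assms(2) s_def by blast
  \<comment> \<open>The lower end has \<open>k - h\<close> labels, that is \<open>h\<close> or
    \<open>h + 1\<close>; in the odd case label \<open>h\<close> is the one left out of
    \<open>R\<close>.\<close>
  define T' where "T' = {..<k - h} \<union> {s - h..<s}"
  have T': "T' \<subseteq> {..<s}" "card T' = k"
    using k by (auto simp: T'_def intro!: trans[OF card_Un_disjoint])
  have "card (S - T) = card ({..<s} - T')"
    using T' assms by (simp add: card_Diff_subset finite_subset s_def k_def)
  then obtain g2 where g2: "bij_betw g2 (S - T) ({..<s} - T')"
    using finite_same_card_bij assms(1) by (metis finite_Diff finite_lessThan)
  obtain g1 where g1: "bij_betw g1 T T'"
    using finite_same_card_bij assms(1,3) T' by (metis finite_subset finite_lessThan k_def)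
  define g where "g x = (if x \<in> T then g1 x else g2 x)" for x
  have gT: "bij_betw g T T'" using g1 by (rule bij_betw_cong[THEN iffD1, rotated]) (simp add: g_def)
  have "bij_betw g (S - T) ({..<s} - T')"
    using g2 by (rule bij_betw_cong[THEN iffD1, rotated]) (simp add: g_def)
  then have "bij_betw g (T \<union> (S - T)) (T' \<union> ({..<s} - T'))"
    using gT by (intro bij_betw_combine) auto
  moreover have "T \<union> (S - T) = S" "T' \<union> ({..<s} - T') = {..<s}" using T' assms(3) by auto
  ultimately have g: "bij_betw g S {..<s}" by simp
  define R where "R = T \<inter> g -` ({..<h} \<union> {s - h..<s})"
  have gR: "g ` R = {..<h} \<union> {s - h..<s}"
  proof -
    have "g ` R = T' \<inter> ({..<h} \<union> {s - h..<s})" using gT by (auto simp: R_def bij_betw_def)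
    then show ?thesis using k by (auto simp: T'_def)
  qed
  have injg: "inj_on g R" using gT by (auto simp: R_def bij_betw_def intro: inj_on_subset)
  then have "card R = card ({..<h} \<union> {s - h..<s})" using gR card_image by metis
  also have "\<dots> = 2 * h" using k by (subst card_Un_disjoint) auto
  finally have cR: "card R = 2 * h" .
  define r where "r = inv_into R g"
  have r: "r y \<in> R" "g (r y) = y" if "y < h \<or> s - h \<le> y \<and> y < s" for y
    using that gR by (auto simp: r_def intro!: inv_into_into f_inv_into_f)
  let ?e = "\<lambda>x. {r x, r (s - 1 - x)}"
  have rr: "r x \<in> R" "r (s - 1 - x) \<in> R" "g (r x) = x" "g (r (s - 1 - x)) = s - 1 - x" if "x < h" for x
  proof -
    have "s - h \<le> s - 1 - x \<and> s - 1 - x < s" using that k by auto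
    then show "r x \<in> R" "r (s - 1 - x) \<in> R" "g (r x) = x" "g (r (s - 1 - x)) = s - 1 - x"
      using r[of x] r[of "s - 1 - x"] that by blast+
  qed
  have e: "?e x \<in> {e \<in> [R]\<^bsup>2\<^esup>. col (g ` e) = 0}" if "x < h" for x
  proof -
    have "x \<noteq> s - 1 - x" "x < s" using that k by auto
    then show ?thesis using rr[OF that] col(2) by auto
  qed
  have ge: "g ` ?e x = {x, s - 1 - x}" if "x < h" for x
    using rr(3,4)[OF that] by simp
  have "inj_on ?e {..<h}"
  proof (rule inj_onI)
    fix x y assume *: "x \<in> {..<h}" "y \<in> {..<h}" "?e x = ?e y"
    have "{x, s - 1 - x} = {y, s - 1 - y}"
      using ge[of x] ge[of y] *(1,2) unfolding *(3) by auto
    then have "x = y \<or> x = s - 1 - y" by (auto simp: doubleton_eq_iff)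
    then show "x = y" using *(1,2) k by auto
  qed
  moreover have "finite {e \<in> [R]\<^bsup>2\<^esup>. col (g ` e) = 0}"
  proof -
    have "R \<subseteq> S" using assms(3) by (auto simp: R_def)
    then have "finite ([R]\<^bsup>2\<^esup>)" using assms(1) finite_imp_finite_nsets finite_subset by metis
    then show ?thesis by simp
  qed
  ultimately have "h \<le> card {e \<in> [R]\<^bsup>2\<^esup>. col (g ` e) = 0}"
    using e card_inj_on_le[of ?e "{..<h}" "{e \<in> [R]\<^bsup>2\<^esup>. col (g ` e) = 0}"] by (simp add: image_subset_iff)
  moreover have "proper_col S (s - 1) (\<lambda>e. col (g ` e))"
    using proper_col_vimage[OF col(1), of g S] g by (simp add: bij_betw_def)
  ultimately show ?thesis
    using that[of "\<lambda>e. col (g ` e)" R] cR by (auto simp: R_def s_def h_def)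
qed

text \<open>With as many colours as vertices, adding labels modulo \<open>s\<close> is proper for
  either parity. Giving \<open>f\<close> the label 0 colours each edge at \<open>f\<close> by the
  nonzero label of its other end.\<close>

lemma near_one_factorization:
  assumes "finite S" "f \<in> S"
  obtains col where "proper_col S (card S) col" "\<And>e. e \<in> [S]\<^bsup>2\<^esup> \<Longrightarrow> f \<in> e \<Longrightarrow> col e \<noteq> 0"
proof -
  define s where "s = card S"
  have "s > 0" using assms by (auto simp: s_def card_gt_0_iff)
  obtain g0 where "bij_betw g0 (S - {f}) {1..<s}"
    using finite_same_card_bij[of "S - {f}" "{1..<s}"] assms by (auto simp: s_def)
  then have "bij_betw (g0(f := 0)) (S - {f}) {1..<s}"
    by (rule bij_betw_cong[THEN iffD1, rotated]) simp
  then have "bij_betw (g0(f := 0)) ((S - {f}) \<union> {f}) ({1..<s} \<union> {0})"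
    by (intro bij_betw_combine) auto
  moreover have "(S - {f}) \<union> {f} = S" "{1..<s} \<union> {0} = {..<s}" using assms \<open>s > 0\<close> by auto
  ultimately obtain g where g: "bij_betw g S {..<s}" "g f = 0" by (metis fun_upd_same)
  have lt: "g x < s" if "x \<in> S" for x using g that by (auto simp: bij_betw_def)
  have ne: "g x \<noteq> g y" if "x \<in> S" "y \<in> S" "x \<noteq> y" for x y
    using g that by (auto simp: bij_betw_def dest: inj_onD)
  define col where "col e = (\<Sum>x\<in>e. g x) mod s" for e
  have "proper_col S s col"
  proof (rule proper_colI)
    fix x y z assume *: "x \<in> S" "y \<in> S" "z \<in> S" "x \<noteq> y" "x \<noteq> z" "col {x, y} = col {x, z}"
    then have "g y = g z" using mod_add_cancel[of "g x" "g y" s "g z"] lt by (simp add: col_def)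
    then show "y = z" using ne * by blast
  qed (use \<open>s > 0\<close> in \<open>simp add: col_def\<close>)
  moreover have "col e \<noteq> 0" if e: "e \<in> [S]\<^bsup>2\<^esup>" "f \<in> e" for e
  proof -
    obtain y where y: "e = {f, y}" "y \<in> S" "y \<noteq> f" using e by (auto elim!: nsets2_E)
    then have "col e = g y" "g y \<noteq> g f" using lt[of y] ne[of y f] g(2) assms(2) by (auto simp: col_def)
    then show ?thesis using g(2) by simp
  qed
  ultimately show ?thesis using that unfolding s_def by blast
qed

subsection \<open>Joining colour classes to apex vertices\<close>

lemma packs_colours:
  assumes "finite S" and col: "proper_col S k col" and D: "D \<subseteq> [S]\<^bsup>2\<^esup>"
    and w: "inj_on w (col ` D)" "\<And>e. e \<in> D \<Longrightarrow> w (col e) \<notin> S"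
    and F: "D \<subseteq> F" "\<And>e x. e \<in> D \<Longrightarrow> x \<in> e \<Longrightarrow> {w (col e), x} \<in> F" and n: "n \<le> card D"
  shows "packs F n"
proof -
  have "packs (D \<union> {{w (col e), x} | e x. e \<in> D \<and> x \<in> e}) (card D)"
  proof (rule packs_apex[OF _ D])
    show "finite D" using D assms(1) finite_imp_finite_nsets finite_subset by metis
    show "e = e'" if "e \<in> D" "e' \<in> D" "col e = col e'" "e \<inter> e' \<noteq> {}" for e e'
      using that col D unfolding proper_col_def by blast
  qed (use w in auto)
  then show ?thesis
    by (rule packs_mono) (use F n in auto)
qed

lemma bipI: "w \<in> W \<Longrightarrow> x \<in> S \<Longrightarrow> {w, x} \<in> bip W S"
  unfolding bip_def by blast

text \<open>Classes 1 to \<open>card W\<close> are perfect and go to the apexes in \<open>W\<close>;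
  class 0, arranged to match almost all of \<open>T\<close>, goes to \<open>g\<close>. Thus
  \<open>g\<close> uses only edges to \<open>R\<close>, and its remaining edges stay free for other
  triangles.\<close>

lemma packs_clique_extra:
  assumes "finite S" "even (card S)" "finite W" "W \<inter> S = {}" "card W + 1 < card S"
    and "T \<subseteq> S" "g \<notin> W" "g \<notin> S"
  obtains R where "R \<subseteq> T" "card R = 2 * (card T div 2)"
    "packs ([S]\<^bsup>2\<^esup> \<union> bip W S \<union> bip {g} R) (card W * (card S div 2) + card T div 2)"
proof -
  obtain col R where col: "proper_col S (card S - 1) col" and R: "R \<subseteq> T" "card R = 2 * (card T div 2)"
    "card T div 2 \<le> card {e \<in> [R]\<^bsup>2\<^esup>. col e = 0}"
    using one_factorization[OF assms(1,2,6)] by blast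
  obtain w0 where w0: "bij_betw w0 {1..card W} W"
    using finite_same_card_bij[of "{1..card W}" W] assms(3) by auto
  define w where "w c = (if c = 0 then g else w0 c)" for c
  define D1 D2 where "D1 = {e \<in> [S]\<^bsup>2\<^esup>. col e \<in> {1..card W}}" and "D2 = {e \<in> [R]\<^bsup>2\<^esup>. col e = 0}"
  have RS: "[R]\<^bsup>2\<^esup> \<subseteq> [S]\<^bsup>2\<^esup>" using R(1) assms(6) by (intro nsets_mono) auto
  have fin: "finite ([S]\<^bsup>2\<^esup>)" using assms(1) by (rule finite_imp_finite_nsets)
  have wW: "w c \<in> W" if "c \<in> {1..card W}" for c using w0 that by (auto simp: w_def bij_betw_def)
  have "packs ([S]\<^bsup>2\<^esup> \<union> bip W S \<union> bip {g} R) (card W * (card S div 2) + card T div 2)"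
  proof (rule packs_colours[OF assms(1) col])
    show "D1 \<union> D2 \<subseteq> [S]\<^bsup>2\<^esup>" using RS by (auto simp: D1_def D2_def)
    then show "D1 \<union> D2 \<subseteq> [S]\<^bsup>2\<^esup> \<union> bip W S \<union> bip {g} R" by blast
    have "inj_on w (insert 0 {1..card W})"
    proof -
      have "inj_on w0 {1..card W}" using w0 by (simp add: bij_betw_def)
      then have "inj_on w {1..card W}" by (rule inj_on_cong[THEN iffD1, rotated]) (simp add: w_def)
      moreover have "w 0 \<notin> w ` {1..card W}" using wW assms(7) by (auto simp: w_def)
      ultimately show ?thesis by simp
    qed
    then show "inj_on w (col ` (D1 \<union> D2))"
      by (rule inj_on_subset) (auto simp: D1_def D2_def)
    show "w (col e) \<notin> S" if "e \<in> D1 \<union> D2" for e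
      using that wW assms(4,8) by (auto simp: D1_def D2_def w_def)
    show "{w (col e), x} \<in> [S]\<^bsup>2\<^esup> \<union> bip W S \<union> bip {g} R" if "e \<in> D1 \<union> D2" "x \<in> e" for e x
    proof (cases "e \<in> D1")
      case True
      then show ?thesis using that(2) wW by (auto simp: D1_def nsets_def intro!: bipI)
    next
      case False
      then have "w (col e) = g" "x \<in> R" using that by (auto simp: D2_def w_def nsets_def)
      then show ?thesis by (auto intro: bipI)
    qed
    have "{1..card W} \<subseteq> {..<card S - 1}" using assms(5) by auto
    then have "card W * (card S div 2) \<le> card D1"
      using card_colours_ge[OF assms(1,2) col, of "{1..card W}"] by (simp add: D1_def)
    moreover have "card (D1 \<union> D2) = card D1 + card D2"
      using fin RS by (intro card_Un_disjoint) (auto simp: D1_def D2_def intro: finite_subset)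
    ultimately show "card W * (card S div 2) + card T div 2 \<le> card (D1 \<union> D2)"
      using R(3) by (simp add: D2_def)
  qed
  then show ?thesis using R that by blast
qed

text \<open>Each vertex of \<open>W\<close> is the apex of one perfect class, which gives
  \<open>card S div 2\<close> triangles.\<close>

lemma packs_clique:
  assumes "finite S" "even (card S)" "finite W" "W \<inter> S = {}" "card W < card S"
  shows "packs ([S]\<^bsup>2\<^esup> \<union> bip W S) (card W * (card S div 2))"
proof -
  obtain col R where col: "proper_col S (card S - 1) col"
    using one_factorization[OF assms(1,2) order_refl] by blast
  obtain w where w: "bij_betw w {..<card W} W"
    using finite_same_card_bij[of "{..<card W}" W] assms(3) by auto
  have wW: "w c \<in> W" if "c < card W" for c using w that by (auto simp: bij_betw_def)
  show ?thesis
  proof (rule packs_colours[OF assms(1) col])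
    let ?D = "{e \<in> [S]\<^bsup>2\<^esup>. col e \<in> {..<card W}}"
    show "?D \<subseteq> [S]\<^bsup>2\<^esup>" "?D \<subseteq> [S]\<^bsup>2\<^esup> \<union> bip W S" by auto
    show "inj_on w (col ` ?D)"
      using w by (auto simp: bij_betw_def intro: inj_on_subset)
    show "w (col e) \<notin> S" if "e \<in> ?D" for e using that wW assms(4) by auto
    show "{w (col e), x} \<in> [S]\<^bsup>2\<^esup> \<union> bip W S" if "e \<in> ?D" "x \<in> e" for e x
      using that wW by (auto simp: nsets_def intro!: bipI)
    show "card W * (card S div 2) \<le> card ?D"
      using card_colours_ge[OF assms(1,2) col, of "{..<card W}"] assms(5) by auto
  qed
qed

text \<open>Every edge of the clique is a base. Colour 0 is absent at \<open>f\<close> and is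
  assigned to \<open>g\<close>, which spares the edge \<open>{g, f}\<close> for a further
  triangle.\<close>

lemma packs_clique_near:
  assumes "finite S" "finite W" "W \<inter> S = {}" "card W = card S" "f \<in> S" "g \<in> W"
  shows "packs ([S]\<^bsup>2\<^esup> \<union> (bip W S - {{g, f}})) (card S choose 2)"
proof -
  obtain col where col: "proper_col S (card S) col" "\<And>e. e \<in> [S]\<^bsup>2\<^esup> \<Longrightarrow> f \<in> e \<Longrightarrow> col e \<noteq> 0"
    using near_one_factorization[OF assms(1,5)] by blast
  have "card S > 0" using assms by (auto simp: card_gt_0_iff)
  obtain w0 where "bij_betw w0 {1..<card W} (W - {g})"
    using finite_same_card_bij[of "{1..<card W}" "W - {g}"] assms(2,6) by auto
  then have "bij_betw (w0(0 := g)) {1..<card W} (W - {g})"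
    by (rule bij_betw_cong[THEN iffD1, rotated]) simp
  then have "bij_betw (w0(0 := g)) ({1..<card W} \<union> {0}) ((W - {g}) \<union> {g})"
    by (intro bij_betw_combine) auto
  moreover have "(W - {g}) \<union> {g} = W" "{1..<card W} \<union> {0} = {..<card S}"
    using assms \<open>card S > 0\<close> by auto
  ultimately obtain w where w: "bij_betw w {..<card S} W" "w 0 = g" by (metis fun_upd_same)
  have c: "col e < card S" if "e \<in> [S]\<^bsup>2\<^esup>" for e using col(1) that by (simp add: proper_col_def)
  have wW: "w (col e) \<in> W" if "e \<in> [S]\<^bsup>2\<^esup>" for e
    using w c[OF that] by (auto simp: bij_betw_def)
  show ?thesis
  proof (rule packs_colours[OF assms(1) col(1)])
    show "[S]\<^bsup>2\<^esup> \<subseteq> [S]\<^bsup>2\<^esup>" "[S]\<^bsup>2\<^esup> \<subseteq> [S]\<^bsup>2\<^esup> \<union> (bip W S - {{g, f}})" by auto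
    show "inj_on w (col ` [S]\<^bsup>2\<^esup>)"
      using w c by (auto simp: bij_betw_def intro: inj_on_subset)
    show "w (col e) \<notin> S" if "e \<in> [S]\<^bsup>2\<^esup>" for e using wW[OF that] assms(3) by auto
    show "{w (col e), x} \<in> [S]\<^bsup>2\<^esup> \<union> (bip W S - {{g, f}})" if e: "e \<in> [S]\<^bsup>2\<^esup>" "x \<in> e" for e x
    proof -
      have "x \<in> S" using e by (auto simp: nsets_def)
      moreover have "{w (col e), x} \<noteq> {g, f}"
      proof
        assume "{w (col e), x} = {g, f}"
        then have "w (col e) = g" "x = f"
          using \<open>x \<in> S\<close> wW[OF e(1)] assms by (auto simp: doubleton_eq_iff)
        then have "w (col e) = w 0" using w(2) by simp
        then have "col e = 0" using w(1) c[OF e(1)] \<open>card S > 0\<close> by (simp add: bij_betw_def inj_on_def)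
        then show False using col(2) e \<open>x = f\<close> by blast
      qed
      ultimately show ?thesis using bipI[OF wW[OF e(1)]] by blast
    qed
    show "card S choose 2 \<le> card ([S]\<^bsup>2\<^esup>)" by (simp add: card_nsets)
  qed
qed

text \<open>Adding labels modulo \<open>card X\<close> is a Latin square colouring of the edges
  between \<open>X\<close> and \<open>Y\<close>. Since \<open>card Y \<le> card X\<close>, labels on
  either side are distinct residues, and every colour has its own apex in \<open>W\<close>.\<close>

lemma packs_tripartite:
  assumes "finite X" "finite Y" "finite W" "X \<inter> Y = {}" "W \<inter> (X \<union> Y) = {}" "card Y \<le> card X" "card W = card X"
  shows "packs (bip X Y \<union> bip W (X \<union> Y)) (card X * card Y)"
proof -
  define s where "s = card X"
  obtain gx where gx: "bij_betw gx X {..<s}"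
    using finite_same_card_bij[OF assms(1) finite_lessThan] s_def by (metis card_lessThan)
  obtain gy where gy: "bij_betw gy Y {..<card Y}"
    using finite_same_card_bij[OF assms(2) finite_lessThan] by (metis card_lessThan)
  obtain w where w: "bij_betw w {..<s} W"
    using finite_same_card_bij[OF finite_lessThan assms(3)] assms(7) s_def by (metis card_lessThan)
  define col where "col e = (\<Sum>v\<in>e. if v \<in> X then gx v else gy v) mod s" for e
  have lx: "gx x < s" if "x \<in> X" for x using gx that by (auto simp: bij_betw_def)
  have ly: "gy y < s" if "y \<in> Y" for y using bij_betwE[OF gy] that assms(6) by (force simp: s_def)
  have c: "col {x, y} = (gx x + gy y) mod s" if "x \<in> X" "y \<in> Y" for x y
  proof -
    have "x \<noteq> y" "y \<notin> X" using that assms(4) by auto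
    then show ?thesis using that by (simp add: col_def)
  qed
  have cl: "col e < s" if "e \<in> bip X Y" for e
  proof -
    have "s > 0" using that assms(1) by (auto simp: bip_def s_def card_gt_0_iff)
    then show ?thesis by (simp add: col_def)
  qed
  have "packs (bip X Y \<union> {{w (col e), x} | e x. e \<in> bip X Y \<and> x \<in> e}) (card (bip X Y))"
  proof (rule packs_apex[where S = "X \<union> Y"])
    show "bip X Y \<subseteq> [X \<union> Y]\<^bsup>2\<^esup>" using assms(4) by (auto simp: bip_def)
    have "bip X Y = (\<lambda>(x, y). {x, y}) ` (X \<times> Y)" by (auto simp: bip_def)
    then show "finite (bip X Y)" using assms by simp
    show "inj_on w (col ` bip X Y)"
      using w cl by (auto simp: bij_betw_def intro: inj_on_subset)
    show "w ` col ` bip X Y \<inter> (X \<union> Y) = {}"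
      using w cl assms(5) by (fastforce simp: bij_betw_def)
    fix e e' assume e: "e \<in> bip X Y" "e' \<in> bip X Y" and eq: "col e = col e'" and "e \<inter> e' \<noteq> {}"
    obtain x y x' y' where xy: "e = {x, y}" "x \<in> X" "y \<in> Y" "e' = {x', y'}" "x' \<in> X" "y' \<in> Y"
      using e by (auto simp: bip_def)
    then have sum: "(gx x + gy y) mod s = (gx x' + gy y') mod s" using eq c by simp
    have "x = x' \<or> y = y'" using \<open>e \<inter> e' \<noteq> {}\<close> xy assms(4) by auto
    then show "e = e'"
    proof
      assume "x = x'"
      then have "gy y = gy y'" using sum mod_add_cancel[of "gx x" "gy y" s "gy y'"] ly xy by simp
      then show ?thesis using gy xy \<open>x = x'\<close> by (auto simp: bij_betw_def dest: inj_onD)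
    next
      assume "y = y'"
      then have "gx x = gx x'" using sum mod_add_cancel[of "gy y" "gx x" s "gx x'"] lx xy by (simp add: add.commute)
      then show ?thesis using gx xy \<open>y = y'\<close> by (auto simp: bij_betw_def dest: inj_onD)
    qed
  qed
  moreover have "card (bip X Y) = card X * card Y"
  proof -
    have "bip X Y = (\<lambda>(x, y). {x, y}) ` (X \<times> Y)" by (auto simp: bip_def)
    moreover have "inj_on (\<lambda>(x, y). {x, y}) (X \<times> Y)"
      using assms(4) by (auto simp: inj_on_def doubleton_eq_iff)
    ultimately show ?thesis by (simp add: card_image card_cartesian_product)
  qed
  moreover have "{w (col e), x} \<in> bip W (X \<union> Y)" if "e \<in> bip X Y" "x \<in> e" for e x
    using that cl[OF that(1)] w by (intro bipI) (auto simp: bij_betw_def bip_def)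
  ultimately show ?thesis by (elim packs_mono) auto
qed

subsection \<open>Isomorphism invariance and cuts\<close>

text \<open>Witnesses in place of the maximum and the minimum make transport along relabellings
  direct.\<close>

definition tuza :: "'a set \<Rightarrow> 'a set set \<Rightarrow> bool" where
  "tuza V E \<longleftrightarrow> (\<exists>P F. finite P \<and> triangle_packing V E P \<and> triangle_hitting V E F \<and> card F \<le> 2 * card P)"

lemma tuza_numbers:
  assumes "finite_simple_graph V E" "tuza V E"
  shows "\<tau> V E \<le> 2 * \<mu> V E"
proof -
  obtain P F where PF: "triangle_packing V E P" "triangle_hitting V E F" "card F \<le> 2 * card P"
    using assms(2) unfolding tuza_def by auto
  have V: "finite V" "E \<subseteq> [V]\<^bsup>2\<^esup>" using assms(1) by (auto simp: finite_simple_graph_def)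
  then have E: "finite E" using finite_imp_finite_nsets finite_subset by metis
  have "{P. triangle_packing V E P} \<subseteq> Pow ([V]\<^bsup>3\<^esup>)"
    by (auto simp: triangle_packing_def triangles_def)
  then have "finite {P. triangle_packing V E P}"
    using V(1) by (meson finite_Pow_iff finite_imp_finite_nsets finite_subset)
  then have "card P \<le> \<mu> V E"
    unfolding packing_number_def using PF(1) by (intro Max_ge) auto
  moreover have "{F. triangle_hitting V E F} \<subseteq> Pow E" by (auto simp: triangle_hitting_def)
  then have "finite {F. triangle_hitting V E F}" using E by (meson finite_Pow_iff finite_subset)
  then have "\<tau> V E \<le> card F"
    unfolding hitting_number_def using PF(2) by (intro Min_le) auto
  ultimately show ?thesis using PF(3) by linarith
qed

lemma nsets_image:
  assumes "inj_on f T"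
  shows "[f ` T]\<^bsup>k\<^esup> = (`) f ` [T]\<^bsup>k\<^esup>"
proof -
  have "\<exists>Y\<subseteq>T. X = f ` Y \<and> finite Y \<and> card Y = card X" if "X \<subseteq> f ` T" "finite X" for X
    using that assms by (metis card_image finite_imageD inj_on_subset subset_imageE)
  moreover have "card (f ` Y) = card Y" if "Y \<subseteq> T" for Y
    using assms that by (meson card_image inj_on_subset)
  ultimately show ?thesis
    unfolding nsets_def by (auto simp: image_iff) blast+
qed

lemma tuza_image:
  assumes f: "inj_on f V" and E: "E \<subseteq> [V]\<^bsup>2\<^esup>" and "tuza V E"
  shows "tuza (f ` V) ((`) f ` E)"
proof -
  obtain P F where P: "finite P" "triangle_packing V E P" and F: "triangle_hitting V E F" and le: "card F \<le> 2 * card P"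
    using assms(3) unfolding tuza_def by auto
  have sub: "[f ` T]\<^bsup>k\<^esup> = (`) f ` [T]\<^bsup>k\<^esup>" if "T \<subseteq> V" for T k
    using f that by (intro nsets_image) (rule inj_on_subset)
  have inj: "inj_on ((`) f) (Pow V)" using f by (rule inj_on_image_Pow)
  have EV: "E \<subseteq> Pow V" using E by (auto simp: nsets_def)
  have PV: "T \<subseteq> V" "T \<in> [V]\<^bsup>3\<^esup>" "[T]\<^bsup>2\<^esup> \<subseteq> E" if "T \<in> P" for T
    using P(2) that by (auto simp: triangle_packing_def triangles_def nsets_def)
  have disj: "disjnt ([f ` S]\<^bsup>2\<^esup>) ([f ` T]\<^bsup>2\<^esup>)" if "S \<in> P" "T \<in> P" "S \<noteq> T" for S T
  proof -
    have "disjnt ([S]\<^bsup>2\<^esup>) ([T]\<^bsup>2\<^esup>)"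
      using P(2) that by (auto simp: triangle_packing_def pairwise_def)
    moreover have "[S]\<^bsup>2\<^esup> \<subseteq> Pow V" "[T]\<^bsup>2\<^esup> \<subseteq> Pow V" using PV(3) that EV by (meson order_trans)+
    ultimately show ?thesis
      using inj_on_image_Int[OF inj, of "[S]\<^bsup>2\<^esup>" "[T]\<^bsup>2\<^esup>"] sub[OF PV(1)] that by (simp add: disjnt_def)
  qed
  have "triangle_packing (f ` V) ((`) f ` E) ((`) f ` P)"
    unfolding triangle_packing_def
  proof
    show "(`) f ` P \<subseteq> triangles (f ` V) ((`) f ` E)"
    proof (intro subsetI)
      fix T' assume "T' \<in> (`) f ` P"
      then obtain T where T: "T \<in> P" "T' = f ` T" by auto
      then have "[T']\<^bsup>2\<^esup> \<subseteq> (`) f ` E" "T' \<in> [f ` V]\<^bsup>3\<^esup>"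
        using PV(2,3)[OF T(1)] sub[OF PV(1)[OF T(1)], of 2] sub[OF order_refl, of 3] by auto
      then show "T' \<in> triangles (f ` V) ((`) f ` E)" by (simp add: triangles_def)
    qed
    show "pairwise (\<lambda>S T. disjnt ([S]\<^bsup>2\<^esup>) ([T]\<^bsup>2\<^esup>)) ((`) f ` P)"
      using disj unfolding pairwise_def by auto
  qed
  moreover have "triangle_hitting (f ` V) ((`) f ` E) ((`) f ` F)"
    unfolding triangle_hitting_def
  proof (intro conjI ballI)
    show "(`) f ` F \<subseteq> (`) f ` E" using F by (auto simp: triangle_hitting_def)
    fix T' assume T': "T' \<in> triangles (f ` V) ((`) f ` E)"
    then obtain T where T: "T \<in> [V]\<^bsup>3\<^esup>" "T' = f ` T"
      using sub[OF order_refl] by (auto simp: triangles_def)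
    have TV: "T \<subseteq> V" "[T]\<^bsup>2\<^esup> \<subseteq> Pow V" using T by (auto simp: nsets_def)
    have "(`) f ` [T]\<^bsup>2\<^esup> \<subseteq> (`) f ` E" using T' T sub[OF TV(1)] by (auto simp: triangles_def)
    then have "d \<in> E" if "d \<in> [T]\<^bsup>2\<^esup>" for d
      using inj_on_image_mem_iff[OF inj, of d E] EV TV(2) that by blast
    then have "[T]\<^bsup>2\<^esup> \<subseteq> E" by blast
    then have "F \<inter> [T]\<^bsup>2\<^esup> \<noteq> {}" using F T by (auto simp: triangle_hitting_def triangles_def)
    then show "(`) f ` F \<inter> [T']\<^bsup>2\<^esup> \<noteq> {}" using sub[OF TV(1)] T(2) by auto
  qed
  moreover have "card ((`) f ` P) = card P"
    using PV(1) inj by (intro card_image) (auto intro: inj_on_subset)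
  moreover have "card ((`) f ` F) = card F"
    using F EV inj by (intro card_image) (auto simp: triangle_hitting_def intro: inj_on_subset)
  ultimately show ?thesis unfolding tuza_def using P(1) le by (metis finite_imageI)
qed

section \<open>The graph on indices, its symmetry and its cuts\<close>

definition vertices :: "nat \<Rightarrow> (nat + nat) set" where
  "vertices n = Inl ` {..<n} \<union> Inr ` {..<n}"

definition edges :: "nat \<Rightarrow> (nat \<Rightarrow> nat \<Rightarrow> bool) \<Rightarrow> (nat + nat) set set" where
  "edges n L = [Inl ` {..<n}]\<^bsup>2\<^esup> \<union> [Inr ` {..<n}]\<^bsup>2\<^esup> \<union> {{Inl i, Inr j} | i j. i < n \<and> j < n \<and> L i j}"

lemma edges_vertices: "edges n L \<subseteq> [vertices n]\<^bsup>2\<^esup>"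
proof -
  have "[Inl ` {..<n}]\<^bsup>2\<^esup> \<subseteq> [vertices n]\<^bsup>2\<^esup>" "[Inr ` {..<n}]\<^bsup>2\<^esup> \<subseteq> [vertices n]\<^bsup>2\<^esup>"
    by (intro nsets_mono; simp add: vertices_def)+
  moreover have "{{Inl i, Inr j} | i j. i < n \<and> j < n \<and> L i j} \<subseteq> [vertices n]\<^bsup>2\<^esup>"
    by (auto simp: vertices_def)
  ultimately show ?thesis by (simp add: edges_def)
qed

text \<open>Transposing \<open>L\<close> exchanges the two cliques; this disposes of the symmetric
  cases.\<close>

lemma tuza_swap:
  assumes "tuza (vertices n) (edges n (\<lambda>i j. L j i))"
  shows "tuza (vertices n) (edges n L)"
proof -
  let ?f = "case_sum Inr Inl :: nat + nat \<Rightarrow> nat + nat"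
  have "inj_on ?f (vertices n)" by (auto simp: inj_on_def vertices_def)
  then have "tuza (?f ` vertices n) ((`) ?f ` edges n (\<lambda>i j. L j i))"
    using tuza_image edges_vertices assms by blast
  moreover have "?f ` vertices n = vertices n" by (auto simp: vertices_def image_Un image_image)
  moreover have "(`) ?f ` edges n (\<lambda>i j. L j i) = edges n L"
  proof -
    have "(`) ?f ` [Inl ` {..<n}]\<^bsup>2\<^esup> = [Inr ` {..<n}]\<^bsup>2\<^esup>" "(`) ?f ` [Inr ` {..<n}]\<^bsup>2\<^esup> = [Inl ` {..<n}]\<^bsup>2\<^esup>"
      by (auto simp: nsets_image[symmetric] inj_on_def image_image)
    moreover have "(`) ?f ` {{Inl i, Inr j} | i j. i < n \<and> j < n \<and> L j i} = {{Inl i, Inr j} | i j. i < n \<and> j < n \<and> L i j}"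
    proof -
      have "(`) ?f ` {{Inl i, Inr j} | i j. i < n \<and> j < n \<and> L j i} = {?f ` {Inl i, Inr j} | i j. i < n \<and> j < n \<and> L j i}"
        by blast
      also have "\<dots> = {{Inl i, Inr j} | i j. i < n \<and> j < n \<and> L i j}"
        by (auto simp: insert_commute)
      finally show ?thesis .
    qed
    ultimately show ?thesis by (auto simp: edges_def image_Un)
  qed
  ultimately show ?thesis by simp
qed

text \<open>Two of the three vertices of a triangle lie on the same side of a bipartition, so the
  uncut edges hit every triangle. \<open>C\<close> may be any finite superset of the uncut cross
  edges, which permits unions of rectangles.\<close>

lemma cut_hitting:
  assumes "I \<subseteq> {..<n}" "J \<subseteq> {..<n}" "finite C"
    and C: "\<And>i j. i < n \<Longrightarrow> j < n \<Longrightarrow> L i j \<Longrightarrow> i \<in> I \<longleftrightarrow> j \<in> J \<Longrightarrow> (i, j) \<in> C"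
  obtains F where "triangle_hitting (vertices n) (edges n L) F"
    "card F \<le> (card I choose 2) + (n - card I choose 2) + (card J choose 2) + (n - card J choose 2) + card C"
proof -
  define X where "X = Inl ` I \<union> Inr ` J"
  define F where "F = {e \<in> edges n L. e \<subseteq> X \<or> e \<inter> X = {}}"
  have hit: "triangle_hitting (vertices n) (edges n L) F"
    unfolding triangle_hitting_def
  proof (intro conjI ballI)
    fix T assume T: "T \<in> triangles (vertices n) (edges n L)"
    then obtain x y z where xyz: "T = {x, y, z}" "x \<noteq> y" "x \<noteq> z" "y \<noteq> z"
      by (auto simp: triangles_def nsets_def card_3_iff)
    then have "{x, y} \<in> edges n L" "{x, z} \<in> edges n L" "{y, z} \<in> edges n L"
      using T by (auto simp: triangles_def)
    then have "{x, y} \<in> F \<or> {x, z} \<in> F \<or> {y, z} \<in> F" by (auto simp: F_def)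
    moreover have "{x, y} \<in> [T]\<^bsup>2\<^esup>" "{x, z} \<in> [T]\<^bsup>2\<^esup>" "{y, z} \<in> [T]\<^bsup>2\<^esup>" using xyz by simp_all
    ultimately show "F \<inter> [T]\<^bsup>2\<^esup> \<noteq> {}" by blast
  qed (simp add: F_def)
  let ?I' = "{..<n} - I" and ?J' = "{..<n} - J"
  have "F \<subseteq> [Inl ` I]\<^bsup>2\<^esup> \<union> [Inl ` ?I']\<^bsup>2\<^esup> \<union> [Inr ` J]\<^bsup>2\<^esup> \<union> [Inr ` ?J']\<^bsup>2\<^esup> \<union> (\<lambda>(i, j). {Inl i, Inr j}) ` C"
  proof
    fix e assume e: "e \<in> F"
    then consider i i' where "e = {Inl i, Inl i'}" "i < n" "i' < n" "i \<noteq> i'"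
      | j j' where "e = {Inr j, Inr j'}" "j < n" "j' < n" "j \<noteq> j'"
      | i j where "e = {Inl i, Inr j}" "i < n" "j < n" "L i j"
    proof -
      have "e \<in> [Inl ` {..<n}]\<^bsup>2\<^esup> \<or> e \<in> [Inr ` {..<n}]\<^bsup>2\<^esup> \<or> (\<exists>i j. e = {Inl i, Inr j} \<and> i < n \<and> j < n \<and> L i j)"
        using e by (auto simp: F_def edges_def)
      then show thesis
      proof (elim disjE)
        assume "e \<in> [Inl ` {..<n}]\<^bsup>2\<^esup>"
        then obtain x y where "e = {x, y}" "x \<in> Inl ` {..<n}" "y \<in> Inl ` {..<n}" "x \<noteq> y"
          by (rule nsets2_E)
        then show thesis using that(1) by blast
      next
        assume "e \<in> [Inr ` {..<n}]\<^bsup>2\<^esup>"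
        then obtain x y where "e = {x, y}" "x \<in> Inr ` {..<n}" "y \<in> Inr ` {..<n}" "x \<noteq> y"
          by (rule nsets2_E)
        then show thesis using that(2) by blast
      next
        assume "\<exists>i j. e = {Inl i, Inr j} \<and> i < n \<and> j < n \<and> L i j"
        then show thesis using that(3) by blast
      qed
    qed
    then show "e \<in> [Inl ` I]\<^bsup>2\<^esup> \<union> [Inl ` ?I']\<^bsup>2\<^esup> \<union> [Inr ` J]\<^bsup>2\<^esup> \<union> [Inr ` ?J']\<^bsup>2\<^esup> \<union> (\<lambda>(i, j). {Inl i, Inr j}) ` C"
    proof cases
      case 1
      then have "i \<in> I \<longleftrightarrow> i' \<in> I" using e by (auto simp: F_def X_def)
      then show ?thesis using 1 by (cases "i \<in> I") simp_all
    next
      case 2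
      then have "j \<in> J \<longleftrightarrow> j' \<in> J" using e by (auto simp: F_def X_def)
      then show ?thesis using 2 by (cases "j \<in> J") simp_all
    next
      case 3
      then have "i \<in> I \<longleftrightarrow> j \<in> J" using e by (auto simp: F_def X_def)
      then have "(i, j) \<in> C" using C 3 by blast
      then show ?thesis using 3(1) by (intro UnI2) (rule image_eqI[of _ _ "(i, j)"], simp_all)
    qed
  qed
  then have "card F \<le> card ([Inl ` I]\<^bsup>2\<^esup> \<union> [Inl ` ?I']\<^bsup>2\<^esup> \<union> [Inr ` J]\<^bsup>2\<^esup> \<union> [Inr ` ?J']\<^bsup>2\<^esup> \<union> (\<lambda>(i, j). {Inl i, Inr j} :: (nat + nat) set) ` C)"
    using assms(1-3) by (intro card_mono) (auto intro!: finite_imp_finite_nsets simp: finite_subset)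
  also have "\<dots> \<le> card ([Inl ` I :: (nat + nat) set]\<^bsup>2\<^esup>) + card ([Inl ` ?I' :: (nat + nat) set]\<^bsup>2\<^esup>)
      + card ([Inr ` J :: (nat + nat) set]\<^bsup>2\<^esup>) + card ([Inr ` ?J' :: (nat + nat) set]\<^bsup>2\<^esup>)
      + card ((\<lambda>(i, j). {Inl i, Inr j} :: (nat + nat) set) ` C)"
    by (intro order_trans[OF card_Un_le] add_right_mono order_refl)
  also have "\<dots> \<le> (card I choose 2) + (n - card I choose 2) + (card J choose 2) + (n - card J choose 2) + card C"
    using assms(1-3) card_image_le[OF assms(3)]
    by (simp add: card_nsets card_image card_Diff_subset finite_subset add_mono)
  finally show ?thesis using that hit by blast
qed

lemma tuzaI:
  assumes "packs R k" "R \<subseteq> edges n L" "triangle_hitting (vertices n) (edges n L) F" "card F \<le> 2 * k"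
  shows "tuza (vertices n) (edges n L)"
proof -
  obtain P where P: "finite P" "k \<le> card P" "\<And>T. T \<in> P \<Longrightarrow> card T = 3 \<and> [T]\<^bsup>2\<^esup> \<subseteq> R"
      "pairwise (\<lambda>S T. disjnt ([S]\<^bsup>2\<^esup>) ([T]\<^bsup>2\<^esup>)) P"
    using assms(1) unfolding packs_def by auto
  have "T \<in> triangles (vertices n) (edges n L)" if "T \<in> P" for T
  proof -
    obtain x y z where T: "T = {x, y, z}" "x \<noteq> y" "x \<noteq> z" "y \<noteq> z"
      using P(3)[OF \<open>T \<in> P\<close>] by (auto simp: card_3_iff)
    have sub: "[T]\<^bsup>2\<^esup> \<subseteq> edges n L" using P(3)[OF that] assms(2) by blast
    moreover have "{x, y} \<in> [T]\<^bsup>2\<^esup>" "{y, z} \<in> [T]\<^bsup>2\<^esup>" using T by simp_all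
    ultimately have "{x, y} \<in> [vertices n]\<^bsup>2\<^esup>" "{y, z} \<in> [vertices n]\<^bsup>2\<^esup>"
      using edges_vertices[of n L] by blast+
    then show ?thesis using T sub by (simp add: triangles_def nsets_def)
  qed
  then have "triangle_packing (vertices n) (edges n L) P"
    using P(4) by (auto simp: triangle_packing_def)
  then show ?thesis unfolding tuza_def using P(1,2) assms(3,4) by fastforce
qed

subsection \<open>Co-chain graphs on initial segments\<close>

lemma nat_disj: "(A :: nat set) \<inter> B = {} \<longleftrightarrow> (\<forall>x\<in>A. x \<notin> B)"
  by auto

lemma sum_disj:
  "Inl ` A \<inter> Inl ` B = {} \<longleftrightarrow> A \<inter> B = {}" "Inr ` C \<inter> Inr ` D = {} \<longleftrightarrow> C \<inter> D = {}"
  "Inl ` A \<inter> Inr ` C = {}" "Inr ` C \<inter> Inl ` A = {}"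
  "Inl i \<notin> Inr ` C" "Inr j \<notin> Inl ` A" "Inl i \<in> Inl ` A \<longleftrightarrow> i \<in> A" "Inr j \<in> Inr ` C \<longleftrightarrow> j \<in> C"
  by auto

text \<open>These rules reduce disjointness of unions of cliques and bipartite regions to statements
  about single indices.\<close>

lemmas region_disj = Int_Un_distrib Int_Un_distrib2 clq_clq clq_bip bip_clq bip_bip sum_disj nat_disj

text \<open>For a region from which one edge has been spared and is then used by another
  triangle.\<close>

lemma diff_disj:
  "A \<inter> B = {} \<Longrightarrow> (A - D) \<inter> B = {}" "A \<inter> B = {} \<Longrightarrow> B \<inter> (A - D) = {}"
  "bip {g} {f} \<inter> (A - {{g, f}}) = {}" "(A - {{g, f}}) \<inter> bip {g} {f} = {}"
  by (auto simp: bip_def)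

text \<open>A single triangle is written as bipartite regions so that the same disjointness rules
  apply.\<close>

lemma packs_three_bip:
  assumes "x \<noteq> y" "y \<noteq> z" "z \<noteq> x"
  shows "packs (bip {x} {y} \<union> bip {y} {z} \<union> bip {z} {x}) 1"
proof (rule packs_mono[OF packs_triangle])
  show "card {x, y, z} = 3" using assms by auto
  show "[{x, y, z}]\<^bsup>2\<^esup> \<subseteq> bip {x} {y} \<union> bip {y} {z} \<union> bip {z} {x}"
    by (auto simp: bip_def nsets_2_eq insert_commute)
qed simp

lemma card_sum_image: "card (Inl ` A) = card A" "card (Inr ` A) = card A"
  by (simp_all add: card_image)

lemma clq_edges: "I \<subseteq> {..<n} \<Longrightarrow> [Inl ` I]\<^bsup>2\<^esup> \<subseteq> edges n L" "I \<subseteq> {..<n} \<Longrightarrow> [Inr ` I]\<^bsup>2\<^esup> \<subseteq> edges n L"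
  using nsets_mono[OF image_mono, of I "{..<n}" _ 2] unfolding edges_def by blast+

lemma bip_clq_subset: "W \<subseteq> S \<Longrightarrow> T \<subseteq> S \<Longrightarrow> W \<inter> T = {} \<Longrightarrow> bip W T \<subseteq> [S]\<^bsup>2\<^esup>"
  by (auto simp: bip_def)

lemma bip_edges_same:
  assumes "I \<subseteq> {..<n}" "J \<subseteq> {..<n}" "I \<inter> J = {}"
  shows "bip (Inl ` I) (Inl ` J) \<subseteq> edges n L" "bip (Inr ` I) (Inr ` J) \<subseteq> edges n L"
proof -
  have "bip (Inl ` I) (Inl ` J) \<subseteq> [Inl ` {..<n}]\<^bsup>2\<^esup>" "bip (Inr ` I) (Inr ` J) \<subseteq> [Inr ` {..<n}]\<^bsup>2\<^esup>"
    using assms by (intro bip_clq_subset; auto)+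
  then show "bip (Inl ` I) (Inl ` J) \<subseteq> edges n L" "bip (Inr ` I) (Inr ` J) \<subseteq> edges n L"
    by (auto simp: edges_def)
qed

lemma bip_commute: "bip W S = bip S W"
  by (auto simp: bip_def insert_commute)

lemma bip_edges_cross:
  assumes "\<And>i j. i \<in> I \<Longrightarrow> j \<in> J \<Longrightarrow> i < n \<and> j < n \<and> L i j"
  shows "bip (Inl ` I) (Inr ` J) \<subseteq> edges n L" "bip (Inr ` J) (Inl ` I) \<subseteq> edges n L"
proof -
  show "bip (Inl ` I) (Inr ` J) \<subseteq> edges n L" using assms unfolding bip_def edges_def by blast
  then show "bip (Inr ` J) (Inl ` I) \<subseteq> edges n L" by (simp add: bip_commute)
qed

lemma two_choose: "2 * (Suc n choose 2) = Suc n * n"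
  by (simp add: choose_two)

text \<open>With m = s + t + 2 the parts have sizes m - t, m + t, m - 1 and m + 1. An imbalance of d
  costs d * d more than an even split, whence the excess \<open>t * t + 1\<close>.\<close>

lemma choose_split:
  "(Suc (Suc s) choose 2) + (Suc (Suc (s + 2 * t)) choose 2) + (Suc (s + t) choose 2) + (Suc (Suc (Suc (s + t))) choose 2)
    = 4 * (Suc (Suc (s + t)) choose 2) + t * t + 1" (is "?l = ?r")
proof -
  have "2 * ?l = 2 * ?r"
    unfolding distrib_left two_choose mult.left_commute[of 2 4] by (simp add: algebra_simps)
  then show ?thesis by simp
qed

section \<open>Downward closed cross adjacency and the basic packing\<close>

locale cochain =
  fixes m :: nat and L :: "nat \<Rightarrow> nat \<Rightarrow> bool"
  assumes m: "even m" "0 < m"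
    and down: "L i j \<Longrightarrow> i' \<le> i \<Longrightarrow> j' \<le> j \<Longrightarrow> L i' j'"
begin

abbreviation "E \<equiv> edges (2 * m) L"
abbreviation "V \<equiv> vertices (2 * m)"

lemma m_gt_1: "Suc 0 < m"
  using m by presburger

lemma choose_half: "m choose 2 = (m - 1) * (m div 2)"
  using m(1) by (auto simp: choose_two elim!: evenE)

abbreviation base_left :: "nat \<Rightarrow> (nat + nat) set set" where
  "base_left f \<equiv> [Inl ` {m..<2*m}]\<^bsup>2\<^esup> \<union> bip (Inl ` ({..<m} - {f})) (Inl ` {m..<2*m})"

abbreviation base_right :: "nat \<Rightarrow> (nat + nat) set set" where
  "base_right f \<equiv> [Inr ` {m..<2*m}]\<^bsup>2\<^esup> \<union> bip (Inr ` ({..<m} - {f})) (Inr ` {m..<2*m})"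

lemma base:
  assumes "f < m" "g < m"
  shows "packs (base_left f \<union> base_right g) (2 * (m choose 2))" "base_left f \<union> base_right g \<subseteq> E"
proof -
  have "packs (base_left f) (m choose 2)"
    using packs_clique[of "Inl ` {m..<2*m}" "Inl ` ({..<m} - {f})"] m assms
    by (simp add: card_sum_image choose_half region_disj)
  moreover have "packs (base_right g) (m choose 2)"
    using packs_clique[of "Inr ` {m..<2*m}" "Inr ` ({..<m} - {g})"] m assms
    by (simp add: card_sum_image choose_half region_disj)
  ultimately have "packs (base_left f \<union> base_right g) ((m choose 2) + (m choose 2))"
    by (rule packs_Un) (simp add: region_disj)
  then show "packs (base_left f \<union> base_right g) (2 * (m choose 2))" by (simp add: mult_2)
  show "base_left f \<union> base_right g \<subseteq> E"
    by (intro Un_least clq_edges bip_edges_same) auto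
qed

text \<open>A balanced cut leaves \<open>4 * (m choose 2)\<close> edges uncut inside the cliques;
  the rest of \<open>2 * k\<close> must cover the cross edges in \<open>C\<close>.\<close>

lemma tuza_balanced:
  assumes "packs R k" "R \<subseteq> E"
    and I: "I \<subseteq> {..<2*m}" "card I = m" and J: "J \<subseteq> {..<2*m}" "card J = m"
    and C: "finite C" "\<And>i j. i < 2*m \<Longrightarrow> j < 2*m \<Longrightarrow> L i j \<Longrightarrow> i \<in> I \<longleftrightarrow> j \<in> J \<Longrightarrow> (i, j) \<in> C"
    and "4 * (m choose 2) + card C \<le> 2 * k"
  shows "tuza V E"
proof -
  obtain F where "triangle_hitting V E F"
    "card F \<le> (card I choose 2) + (2*m - card I choose 2) + (card J choose 2) + (2*m - card J choose 2) + card C"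
    using cut_hitting[OF I(1) J(1) C] by blast
  then show ?thesis
    using assms(9) I(2) J(2) by (intro tuzaI[OF assms(1,2)]) auto
qed

text \<open>The basic packing pays exactly for the clique part of a balanced cut, so
  \<open>x\<close> is the contribution towards the cross edges.\<close>

lemma base_extend:
  assumes "f < m" "g < m" "packs R x" "R \<subseteq> E" "(base_left f \<union> base_right g) \<inter> R = {}"
  obtains R' where "packs R' (2 * (m choose 2) + x)" "R' \<subseteq> E"
proof
  show "packs (base_left f \<union> base_right g \<union> R) (2 * (m choose 2) + x)"
    using base(1) assms(1-3,5) by (intro packs_Un) auto
  show "base_left f \<union> base_right g \<union> R \<subseteq> E"
    using base(2) assms(1,2,4) by auto
qed

lemma half_mult: "2 * (x * (m div 2)) = x * m" "2 * (m choose 2) + m = m * m"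
  using m by (auto simp: choose_half algebra_simps elim!: evenE)

text \<open>All of \<open>A\<^sub>1\<close> is joined to \<open>Inr m\<close> and to
  \<open>B\<^sub>1\<close>. One class of \<open>A\<^sub>1\<close> takes the apex
  \<open>Inr m\<close>, and all classes of \<open>B\<^sub>1\<close> take apexes in
  \<open>A\<^sub>1\<close>; twice the number of these extra triangles is
  \<open>m * m\<close>.\<close>

lemma fan_packs:
  assumes "L (m - 1) m"
  obtains R where "packs R (2 * (m choose 2) + (m div 2 + (m choose 2)))" "R \<subseteq> E"
proof -
  let ?R = "([Inl ` {..<m}]\<^bsup>2\<^esup> \<union> bip (Inr ` {m}) (Inl ` {..<m})) \<union> ([Inr ` {..<m}]\<^bsup>2\<^esup> \<union> bip (Inl ` {..<m - 1}) (Inr ` {..<m}))"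
  have "packs ([Inl ` {..<m}]\<^bsup>2\<^esup> \<union> bip (Inr ` {m}) (Inl ` {..<m})) (m div 2)"
    using packs_clique[of "Inl ` {..<m}" "Inr ` {m}"] m
    by (simp add: card_sum_image region_disj m_gt_1)
  moreover have "packs ([Inr ` {..<m}]\<^bsup>2\<^esup> \<union> bip (Inl ` {..<m - 1}) (Inr ` {..<m})) (m choose 2)"
    using packs_clique[of "Inr ` {..<m}" "Inl ` {..<m - 1}"] m
    by (simp add: card_sum_image choose_half region_disj)
  ultimately have "packs ?R (m div 2 + (m choose 2))"
    by (rule packs_Un) (simp add: region_disj)
  moreover have "?R \<subseteq> E"
    using m down[OF assms] by (intro Un_least clq_edges bip_edges_cross) auto
  moreover have "(base_left 0 \<union> base_right 0) \<inter> ?R = {}"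
    by (simp add: region_disj)
  ultimately show ?thesis using base_extend[OF m(2) m(2)] that by blast
qed

section \<open>Second halves not joined\<close>

text \<open>Cutting first halves from second halves leaves only cross edges between
  \<open>A\<^sub>1\<close> and \<open>B\<^sub>1\<close> uncut, at most \<open>m * m\<close>, and
  \<open>fan_packs\<close> pays for these.\<close>

lemma left_full:
  assumes "\<not> L m m" "L (m - 1) m"
  shows "tuza V E"
proof -
  obtain R where "packs R (2 * (m choose 2) + (m div 2 + (m choose 2)))" "R \<subseteq> E"
    using fan_packs[OF assms(2)] by blast
  then show ?thesis
  proof (rule tuza_balanced[where I = "{..<m}" and J = "{..<m}" and C = "{..<m} \<times> {..<m}"])
    show "(i, j) \<in> {..<m} \<times> {..<m}" if "L i j" "i \<in> {..<m} \<longleftrightarrow> j \<in> {..<m}" for i j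
      using that assms(1) down[of i j m m] by (cases "i < m") auto
    show "4 * (m choose 2) + card ({..<m} \<times> {..<m}) \<le> 2 * (2 * (m choose 2) + (m div 2 + (m choose 2)))"
      using half_mult(1)[of 1] half_mult(2) by (simp add: card_cartesian_product)
  qed auto
qed

text \<open>Left vertices with index in \<open>{p..<m + p}\<close> have no neighbour in
  \<open>B\<^sub>2\<close> and are put on its side. On the side of \<open>B\<^sub>1\<close> there
  remain \<open>p\<close> vertices with at most \<open>m\<close> neighbours there and
  \<open>m - p\<close> vertices with at most \<open>q\<close>.\<close>

lemma tuza_hook:
  assumes Lp: "\<And>i. L i m \<longleftrightarrow> i < p" and Lq: "\<And>j. L m j \<longleftrightarrow> j < q" and "p < m" "q < m"
    and R: "packs R x" "R \<subseteq> E" "(base_left f \<union> base_right g) \<inter> R = {}" "f < m" "g < m"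
    and x: "p * m + (m - p) * q \<le> 2 * x"
  shows "tuza V E"
proof -
  have far: "j < q" if "L i j" "m \<le> i" for i j
    using Lq down[OF that(1), of m j] that(2) by auto
  have near: "i < p" if "L i j" "m \<le> j" for i j
    using Lp down[OF that(1), of i m] that(2) by auto
  obtain R' where "packs R' (2 * (m choose 2) + x)" "R' \<subseteq> E"
    using base_extend[OF R(4,5,1-3)] by blast
  then show ?thesis
  proof (rule tuza_balanced)
    let ?I = "{..<p} \<union> {m + p..<2*m}" and ?C = "{..<p} \<times> {..<m} \<union> {m + p..<2*m} \<times> {..<q}"
    show "?I \<subseteq> {..<2*m}" "{..<m} \<subseteq> {..<2*m}" "card {..<m} = m" "finite ?C" using assms(3) by auto
    show "card ?I = m" using assms(3) by (subst card_Un_disjoint) auto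
    show "(i, j) \<in> ?C" if "i < 2*m" "j < 2*m" "L i j" "i \<in> ?I \<longleftrightarrow> j \<in> {..<m}" for i j
      using that near[of i j] far[of i j] by auto
    have "card ?C \<le> p * m + (m - p) * q"
      by (intro order_trans[OF card_Un_le]) (simp add: card_cartesian_product)
    then show "4 * (m choose 2) + card ?C \<le> 2 * (2 * (m choose 2) + x)" using x by simp
  qed
qed

text \<open>The first \<open>q\<close> vertices of \<open>B\<^sub>1\<close> are apexes for classes
  of \<open>A\<^sub>1\<close>, and the first \<open>p\<close> vertices of \<open>A\<^sub>1\<close>
  are apexes for the other \<open>m - q\<close> vertices of \<open>B\<^sub>1\<close>, an even
  number. Nothing is lost to rounding, as
  \<open>p * m + (m - p) * q = q * m + p * (m - q)\<close>.\<close>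

lemma hook_even:
  assumes Lp: "\<And>i. L i m \<longleftrightarrow> i < p" and Lq: "\<And>j. L m j \<longleftrightarrow> j < q" and "p + q < m" "even q"
  shows "tuza V E"
proof (rule tuza_hook[OF Lp Lq])
  let ?R1 = "[Inl ` {..<m}]\<^bsup>2\<^esup> \<union> bip (Inr ` {..<q}) (Inl ` {..<m}) :: (nat + nat) set set"
  let ?R2 = "[Inr ` {q..<m}]\<^bsup>2\<^esup> \<union> bip (Inl ` {..<p}) (Inr ` {q..<m}) :: (nat + nat) set set"
  have "packs ?R1 (q * (m div 2))"
    using packs_clique[of "Inl ` {..<m}" "Inr ` {..<q}"] m assms
    by (simp add: card_sum_image region_disj)
  moreover have "packs ?R2 (p * ((m - q) div 2))"
    using packs_clique[of "Inr ` {q..<m}" "Inl ` {..<p}"] m assms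
    by (simp add: card_sum_image region_disj)
  ultimately show "packs (?R1 \<union> ?R2) (q * (m div 2) + p * ((m - q) div 2))"
    by (rule packs_Un) (simp add: region_disj)
  have "L i j" if "j < q" "i < m" for i j using Lq[of j] down[of m j i j] that by auto
  moreover have "L i j" if "i < p" "j < m" for i j using Lp[of i] down[of i m i j] that by auto
  ultimately show "?R1 \<union> ?R2 \<subseteq> E"
    using assms by (intro Un_least clq_edges bip_edges_cross) auto
  show "(base_left 0 \<union> base_right 0) \<inter> (?R1 \<union> ?R2) = {}"
    by (simp add: region_disj)
  have "2 * ((m - q) div 2) = m - q" using assms m by auto
  then have "2 * (p * ((m - q) div 2)) = p * (m - q)" by (metis mult.left_commute)
  moreover obtain d where "m = p + q + d" using assms(3) le_Suc_ex less_imp_le by blast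
  then have "p * m + (m - p) * q = q * m + p * (m - q)" by (simp add: algebra_simps)
  ultimately show "p * m + (m - p) * q \<le> 2 * (q * (m div 2) + p * ((m - q) div 2))"
    using half_mult(1)[of q] by (simp only: distrib_left)
qed (use assms in auto)

lemma hook_odd:
  assumes Lp: "\<And>i. L i m \<longleftrightarrow> i < p" and Lq: "\<And>j. L m j \<longleftrightarrow> j < q" and pq: "p + q < m" "odd q"
  shows "tuza V E"
proof -
  let ?S = "Inl ` {..<m} :: (nat + nat) set" and ?S' = "Inr ` {q - 1..<m} :: (nat + nat) set"
  have q: "0 < q" using pq(2) by presburger
  let ?P = "Inl ` {p..<m} :: (nat + nat) set" and ?Q = "Inr ` {..<q - 1} :: (nat + nat) set"
  obtain R where R': "R \<subseteq> ?P" "card R = 2 * (card ?P div 2)"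
    "packs ([?S]\<^bsup>2\<^esup> \<union> bip ?Q ?S \<union> bip {Inr (q - 1)} R) (card ?Q * (card ?S div 2) + card ?P div 2)"
    by (rule packs_clique_extra[of ?S ?Q ?P "Inr (q - 1)"])
      (use m q pq(1) in \<open>auto simp: card_sum_image region_disj\<close>)
  then have R: "R \<subseteq> ?P" "card R = 2 * ((m - p) div 2)"
    and packs1: "packs ([?S]\<^bsup>2\<^esup> \<union> bip ?Q ?S \<union> bip {Inr (q - 1)} R) ((q - 1) * (m div 2) + (m - p) div 2)"
    by (simp_all add: card_sum_image)
  obtain R0 where R0: "R = Inl ` R0" "R0 \<subseteq> {p..<m}" using R(1) by (auto simp: subset_image_iff)
  then have R0': "\<forall>x\<in>R0. \<not> x < p" "\<forall>x<p. x \<notin> R0" "\<forall>x\<in>R0. \<not> m \<le> x" by fastforce+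
  have packs2: "packs ([?S']\<^bsup>2\<^esup> \<union> bip (Inl ` {..<p}) ?S') (p * ((m - (q - 1)) div 2))"
    using packs_clique[of ?S' "Inl ` {..<p}"] m pq q by (simp add: card_sum_image region_disj)
  let ?R = "([?S]\<^bsup>2\<^esup> \<union> bip (Inr ` {..<q - 1}) ?S \<union> bip {Inr (q - 1)} R) \<union> ([?S']\<^bsup>2\<^esup> \<union> bip (Inl ` {..<p}) ?S')"
  let ?x = "((q - 1) * (m div 2) + (m - p) div 2) + p * ((m - (q - 1)) div 2)"
  have packsR: "packs ?R ?x"
    using R0' by (intro packs_Un[OF packs1 packs2]) (simp add: region_disj R0(1))
  have Lj: "L i j" if "j < q" "i \<le> m" for i j using Lq[of j] down[of m j i j] that by auto
  have Li: "L i j" if "i < p" "j \<le> m" for i j using Lp[of i] down[of i m i j] that by auto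
  have "bip {Inr (q - 1)} (Inl ` R0) \<subseteq> E"
    using bip_edges_cross(2)[of R0 "{q - 1}" "2 * m" L] R0(2) pq q Lj by fastforce
  then have RE: "?R \<subseteq> E"
    using pq q Lj Li R0(1) by (intro Un_least clq_edges bip_edges_cross) auto
  have Rbase: "(base_left f \<union> base_right 0) \<inter> ?R = {}" for f
    using R0' q by (simp add: region_disj R0(1))
  have a: "2 * ((q - 1) * (m div 2)) + m = q * m"
    using half_mult(1)[of "q - 1"] q by (cases q) auto
  have "2 * ((m - (q - 1)) div 2) = m - (q - 1)" using pq q m by auto
  then have b: "2 * (p * ((m - (q - 1)) div 2)) = p * (m - (q - 1))" by (metis mult.left_commute)
  have c: "p * (m - (q - 1)) + p * q = p * m + p"
    using pq(1) q by (cases q) (simp_all add: diff_mult_distrib2 algebra_simps)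
  have d: "(m - p) * q + p * q = q * m" using pq(1) by (simp add: diff_mult_distrib algebra_simps)
  show ?thesis
  proof (cases "even p")
    case True
    then have even: "2 * ((m - p) div 2) + p = m" using m pq(1) by auto
    \<comment> \<open>Variables stand for the products, which makes the claim linear;
      \<open>a\<close> to \<open>d\<close> are the relations between them.\<close>
    have "P + D \<le> 2 * ((X + h) + Y)"
      if "2 * h + p = m" "2 * X + m = Q" "2 * Y = Z" "Z + W = P + p" "D + W = Q" for P D X Y Z W Q h :: nat
      using that by presburger
    from this[OF even a b c d] have "p * m + (m - p) * q \<le> 2 * ?x" .
    then show ?thesis
      using pq(1) m by (intro tuza_hook[OF Lp Lq _ _ packsR RE Rbase[of 0]]) auto
  next
    case False
    then have odd: "2 * ((m - p) div 2) + p + 1 = m"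
      using m pq(1) odd_two_times_div_two_succ[of "m - p"] by auto
    have "2 * h < m - p" if "2 * h + p + 1 = m" for h
      using that by linarith
    from this[OF odd] have "card R < card {p..<m}" by (simp only: R(2) card_atLeastLessThan)
    then have "R0 \<noteq> {p..<m}" by (auto simp: R0(1) card_sum_image)
    then obtain f where f: "f \<notin> R0" "p \<le> f" "f < m" using R0(2) by fastforce
    let ?T = "bip {Inl f} {Inl m} \<union> bip {Inl m} {Inr (q - 1)} \<union> bip {Inr (q - 1)} {Inl f}"
    have "packs ?T 1" using f by (intro packs_three_bip) auto
    moreover have "m \<notin> R0" using R0(2) by auto
    ultimately have T: "packs (?R \<union> ?T) (?x + 1)"
      using f pq q by (intro packs_Un[OF packsR]) (auto simp: region_disj R0(1))
    have "?T \<subseteq> E"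
      using bip_edges_same(1)[of "{f}" "2 * m" "{m}" L] bip_edges_cross(1)[of "{m}" "{q - 1}" "2 * m" L]
        bip_edges_cross(2)[of "{f}" "{q - 1}" "2 * m" L] f pq q Lj by (intro Un_least) auto
    then have TE: "?R \<union> ?T \<subseteq> E" using RE by blast
    have "(base_left f \<union> base_right 0) \<inter> ?T = {}"
      using f pq q by (auto simp: region_disj)
    then have Tbase: "(base_left f \<union> base_right 0) \<inter> (?R \<union> ?T) = {}"
      using Rbase[of f] by (simp add: Int_Un_distrib)
    have "P + D \<le> 2 * ((X + h) + Y + 1)"
      if "2 * h + p + 1 = m" "2 * X + m = Q" "2 * Y = Z" "Z + W = P + p" "D + W = Q" for P D X Y Z W Q h :: nat
      using that by presburger
    from this[OF odd a b c d] have "p * m + (m - p) * q \<le> 2 * (?x + 1)" .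
    then show ?thesis
      using pq(1) m f by (intro tuza_hook[OF Lp Lq _ _ T TE Tbase]) auto
  qed
qed

text \<open>Here all edges inside \<open>{p..<m}\<close> are joined to apexes in \<open>B\<^sub>1\<close>. The balanced cut is too
  expensive; deviating by \<open>m - p - 1\<close> on the left and by \<open>1\<close> on the right saves more cross
  edges than it costs inside the cliques.\<close>

lemma hook_large:
  assumes Lp: "\<And>i. L i m \<longleftrightarrow> i < p" and Lq: "\<And>j. L m j \<longleftrightarrow> j < q"
    and pq: "p < m" "q \<le> p" "m \<le> p + q"
  shows "tuza V E"
proof -
  have far: "j < q" if "L i j" "m \<le> i" for i j
    using Lq down[OF that(1), of m j] that(2) by auto
  have near: "i < p" if "L i j" "m \<le> j" for i j
    using Lp down[OF that(1), of i m] that(2) by auto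
  have Lj: "L i j" if "j < q" "i \<le> m" for i j using Lq[of j] down[of m j i j] that by auto
  have Li: "L i j" if "i < p" "j \<le> m" for i j using Lp[of i] down[of i m i j] that by auto
  have q: "0 < q" using pq by auto
  let ?S = "Inr ` {..<m} :: (nat + nat) set" and ?S' = "Inl ` {p..<m} :: (nat + nat) set"
  have packs1: "packs ([?S]\<^bsup>2\<^esup> \<union> bip (Inl ` {..<p}) ?S) (p * (m div 2))"
    using packs_clique[of ?S "Inl ` {..<p}"] m pq by (simp add: card_sum_image region_disj)
  have packs2: "packs ([?S']\<^bsup>2\<^esup> \<union> (bip (Inr ` {..<m - p}) ?S' - {{Inr 0, Inl p}})) (m - p choose 2)"
    using packs_clique_near[of ?S' "Inr ` {..<m - p}" "Inl p" "Inr 0"] pq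
    by (simp add: card_sum_image region_disj)
  let ?T = "bip {Inl p} {Inl m} \<union> bip {Inl m} {Inr 0} \<union> bip {Inr 0} {Inl p} :: (nat + nat) set set"
  have packs3: "packs ?T 1" using pq by (intro packs_three_bip) auto
  let ?R = "([?S]\<^bsup>2\<^esup> \<union> bip (Inl ` {..<p}) ?S) \<union> ([?S']\<^bsup>2\<^esup> \<union> (bip (Inr ` {..<m - p}) ?S' - {{Inr 0, Inl p}})) \<union> ?T"
  have "packs ?R (p * (m div 2) + (m - p choose 2) + 1)"
    using pq by (intro packs_Un[OF packs_Un[OF packs1 packs2] packs3]) (simp_all add: region_disj diff_disj)
  moreover have "?R \<subseteq> E"
  proof -
    have "bip (Inr ` {..<m - p}) ?S' \<subseteq> E" using pq Lj by (intro bip_edges_cross) auto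
    moreover have "?T \<subseteq> E"
      using bip_edges_same(1)[of "{p}" "2 * m" "{m}" L] bip_edges_cross(1)[of "{m}" "{0}" "2 * m" L]
        bip_edges_cross(2)[of "{p}" "{0}" "2 * m" L] pq q Lj by (intro Un_least) auto
    moreover have "[?S]\<^bsup>2\<^esup> \<union> bip (Inl ` {..<p}) ?S \<subseteq> E" "[?S']\<^bsup>2\<^esup> \<subseteq> E"
      using pq Li by (intro Un_least clq_edges bip_edges_cross; auto)+
    ultimately show ?thesis by blast
  qed
  moreover have "(base_left p \<union> base_right 0) \<inter> ?R = {}"
    using pq by (simp add: region_disj diff_disj)
  ultimately obtain R' where R': "packs R' (2 * (m choose 2) + (p * (m div 2) + (m - p choose 2) + 1))" "R' \<subseteq> E"
    using base_extend[of p 0] pq(1) m(2) by blast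
  let ?I = "{..<p} \<union> {m}" and ?J = "{..<m - 1}"
  \<comment> \<open>The rectangles come from \<open>{..<p}\<close> against the reduced
    \<open>J\<close>, from the vertex \<open>m\<close> with its \<open>q\<close> neighbours, and
    from \<open>m - 1\<close>, which now shares a side with \<open>{p..<m}\<close>.\<close>
  let ?C = "{..<p} \<times> {..<m - 1} \<union> {m} \<times> {..<q} \<union> {p..<m} \<times> {m - 1}"
  have C: "(i, j) \<in> ?C" if "i < 2*m" "j < 2*m" "L i j" "i \<in> ?I \<longleftrightarrow> j \<in> ?J" for i j
  proof (cases "i \<in> ?I")
    case True
    then show ?thesis using that far[of i j] by auto
  next
    case False
    then have j: "m - 1 \<le> j" "p \<le> i" "i \<noteq> m" using that by auto
    then have "j = m - 1" using near[of i j] that(3) by linarith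
    moreover have "i < m" using far[of i j] that(3) pq j \<open>j = m - 1\<close> by linarith
    ultimately show ?thesis using j by auto
  qed
  have "?I \<subseteq> {..<2*m}" "?J \<subseteq> {..<2*m}" "finite ?C" using pq(1) by auto
  from this C obtain F where F: "triangle_hitting V E F"
    "card F \<le> (card ?I choose 2) + (2*m - card ?I choose 2) + (card ?J choose 2) + (2*m - card ?J choose 2) + card ?C"
    by (rule cut_hitting)
  have cI: "card ?I = p + 1" using pq by simp
  have cC: "card ?C \<le> p * (m - 1) + q + (m - p)"
    by (intro order_trans[OF card_Un_le] add_mono) (simp_all add: card_cartesian_product)
  obtain t where t: "m = p + Suc t" using pq(1) less_iff_Suc_add by auto
  obtain s where s: "p = Suc s" using pq q by (cases p) auto
  have "2 * m - card ?I = Suc (Suc (s + 2 * t))" "2 * m - card ?J = Suc (Suc (Suc (s + t)))"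
    "card ?J = Suc (s + t)" "card ?I = Suc (Suc s)" "m = Suc (Suc (s + t))"
    using cI s t by auto
  then have "card F \<le> 4 * (m choose 2) + t * t + 1 + card ?C"
    using F(2) choose_split[of s t] by (simp only:)
  moreover have "p * (m - 1) + p = p * m" using m(2) by (cases m) auto
  ultimately have "card F \<le> 4 * (m choose 2) + p * m + t * t + t + 2"
    using cC pq(2) t by linarith
  \<comment> \<open>The bound is met exactly: \<open>m - p\<close> is \<open>t + 1\<close>, so
    \<open>2 * (m - p choose 2)\<close> equals \<open>t * t + t\<close>.\<close>
  also have "\<dots> = 2 * (2 * (m choose 2) + (p * (m div 2) + (m - p choose 2) + 1))"
    using two_choose[of t] half_mult(1)[of p] t by (simp add: distrib_left)
  finally have "card F \<le> 2 * (2 * (m choose 2) + (p * (m div 2) + (m - p choose 2) + 1))" .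
  then show ?thesis using tuzaI[OF R' F(1)] by blast
qed

section \<open>Second halves joined\<close>

text \<open>First halves are cut from second halves. By downward closure the uncut cross edges
  between second halves lie in a \<open>p\<close> by \<open>q\<close> rectangle, for which upper
  bounds on the neighbours of \<open>Inr m\<close> and \<open>Inl m\<close> suffice.\<close>

lemma tuza_square:
  assumes Lp: "\<And>i. i < m \<Longrightarrow> L (m + i) m \<Longrightarrow> i < p"
    and Lq: "\<And>j. j < m \<Longrightarrow> L m (m + j) \<Longrightarrow> j < q" and pq: "p \<le> m" "q \<le> m"
    and R: "packs R k" "R \<subseteq> E" and k: "4 * (m choose 2) + (m * m + p * q) \<le> 2 * k"
  shows "tuza V E"
proof (rule tuza_balanced[OF R])
  let ?C = "{..<m} \<times> {..<m} \<union> {m..<m + p} \<times> {m..<m + q}"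
  show "(i, j) \<in> ?C" if "i < 2*m" "j < 2*m" "L i j" "i \<in> {..<m} \<longleftrightarrow> j \<in> {..<m}" for i j
  proof (cases "i < m")
    case False
    then have "m \<le> i" "m \<le> j" using that by auto
    then have "L (m + (i - m)) m" "L m (m + (j - m))" using down[OF that(3)] by auto
    moreover have "i - m < m" "j - m < m" using that(1,2) \<open>m \<le> i\<close> \<open>m \<le> j\<close> by auto
    ultimately have "i - m < p" "j - m < q" using Lp Lq by blast+
    then show ?thesis using \<open>m \<le> i\<close> \<open>m \<le> j\<close> by auto
  qed (use that in auto)
  have "card ?C \<le> m * m + p * q"
    by (intro order_trans[OF card_Un_le]) (simp add: card_cartesian_product)
  then show "4 * (m choose 2) + card ?C \<le> 2 * k" using k by simp
qed (use pq in auto)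

text \<open>All left vertices are joined to \<open>B\<^sub>1\<close>, so the edges between
  \<open>A\<^sub>1\<close> and \<open>A\<^sub>2\<close> can be bases with apexes in
  \<open>B\<^sub>1\<close>; this replaces the left half of the basic packing.\<close>

lemma square_full:
  assumes Lp: "\<And>i. i < m \<Longrightarrow> L (m + i) m" and Lq: "\<And>j. j < m \<Longrightarrow> L m (m + j) \<longleftrightarrow> j < q"
    and q: "0 < q" "q \<le> m"
  shows "tuza V E"
proof -
  \<comment> \<open>\<open>A\<^sub>1\<close> has only \<open>m - 1\<close> colour classes. The count
    has a slack of \<open>m\<close>, which covers the missing class when
    \<open>q = m\<close>.\<close>
  define q' where "q' = min q (m - 1)"
  let ?A1 = "Inl ` {..<m} :: (nat + nat) set" and ?A2 = "Inl ` {m..<2*m} :: (nat + nat) set"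
  have packs1: "packs (bip ?A1 ?A2 \<union> bip (Inr ` {..<m}) (?A1 \<union> ?A2)) (m * m)"
    using packs_tripartite[of ?A1 ?A2 "Inr ` {..<m}"] by (simp add: card_sum_image region_disj)
  have packs2: "packs ([?A1]\<^bsup>2\<^esup> \<union> bip (Inr ` {m..<m + q'}) ?A1) (q' * (m div 2))"
    using packs_clique[of ?A1 "Inr ` {m..<m + q'}"] m by (simp add: card_sum_image region_disj q'_def)
  have packs3: "packs (base_right 0) (m choose 2)"
    using packs_clique[of "Inr ` {m..<2*m}" "Inr ` ({..<m} - {0})"] m
    by (simp add: card_sum_image choose_half region_disj)
  have L1: "L i j" if "i < 2*m" "j \<le> m" for i j
    using Lp[of "m - 1"] m(2) that down[of "m + (m - 1)" m i j] by auto
  have L2: "L i j" if "i < m" "j < m + q'" for i j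
    using Lq[of "q' - 1"] that down[of m "m + (q' - 1)" i j] q m_gt_1 by (auto simp: q'_def)
  have "{..<m} \<union> {m..<2*m} = {..<2*m}" by auto
  then have un: "?A1 \<union> ?A2 = Inl ` {..<2*m}" by (metis image_Un)
  show ?thesis
  proof (rule tuza_square[where p = m and q = q])
    let ?R = "(bip ?A1 ?A2 \<union> bip (Inr ` {..<m}) (?A1 \<union> ?A2)) \<union> ([?A1]\<^bsup>2\<^esup> \<union> bip (Inr ` {m..<m + q'}) ?A1) \<union> base_right 0"
    show "packs ?R (m * m + q' * (m div 2) + (m choose 2))"
      by (intro packs_Un[OF packs_Un[OF packs1 packs2] packs3]) (simp_all add: region_disj)
    show "?R \<subseteq> E"
      unfolding un using L1 L2 q by (intro Un_least clq_edges bip_edges_same bip_edges_cross) (auto simp: q'_def)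
    have "m * q \<le> m * (q' + 1)" using q by (intro mult_le_mono) (auto simp: q'_def)
    then have Q: "m * q \<le> q' * m + m" by (simp add: algebra_simps)
    have "4 * c + (M + Q) \<le> 2 * (M + X + c)"
      if "2 * X = Z" "2 * c + m = M" "Q \<le> Z + m" for c M Q X Z :: nat
      using that by presburger
    from this[OF half_mult(1) half_mult(2) Q]
    show "4 * (m choose 2) + (m * m + m * q) \<le> 2 * (m * m + q' * (m div 2) + (m choose 2))" .
  qed (use Lq q in auto)
qed

lemma rows_packs:
  assumes "I \<subseteq> {..<2*m}" "card I = m - 1"
  shows "packs ([Inr ` {..<m}]\<^bsup>2\<^esup> \<union> bip (Inl ` I) (Inr ` {..<m})) (m choose 2)"
proof -
  have "finite I" using assms(1) finite_subset by blast
  then show ?thesis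
    using packs_clique[of "Inr ` {..<m}" "Inl ` I"] m assms(2)
    by (simp add: card_sum_image choose_half region_disj)
qed

text \<open>All classes of \<open>B\<^sub>1\<close> and \<open>q\<close> classes of
  \<open>A\<^sub>1\<close> add triangles whose doubled number is \<open>m * m - m + q * m\<close>.
  This reaches \<open>m * m + p * q\<close> exactly when \<open>m \<le> q * (m - p)\<close>.\<close>

lemma square_wide:
  assumes Lp: "\<And>i. i < m \<Longrightarrow> L (m + i) m \<longleftrightarrow> i < p" and Lq: "\<And>j. j < m \<Longrightarrow> L m (m + j) \<longleftrightarrow> j < q"
    and pq: "0 < p" "p < m" "0 < q" "q < m" "m \<le> q * (m - p)"
  shows "tuza V E"
proof -
  let ?I = "{m..<m + p} \<union> {..<m - 1 - p}"
  let ?R1 = "[Inr ` {..<m}]\<^bsup>2\<^esup> \<union> bip (Inl ` ?I) (Inr ` {..<m}) :: (nat + nat) set set"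
  let ?R2 = "[Inl ` {..<m}]\<^bsup>2\<^esup> \<union> bip (Inr ` {m..<m + q}) (Inl ` {..<m}) :: (nat + nat) set set"
  have "card ?I = m - 1" using pq by (subst card_Un_disjoint) auto
  then have packs1: "packs ?R1 (m choose 2)" using pq by (intro rows_packs) auto
  have packs2: "packs ?R2 (q * (m div 2))"
    using packs_clique[of "Inl ` {..<m}" "Inr ` {m..<m + q}"] m pq by (simp add: card_sum_image region_disj)
  have "packs (?R1 \<union> ?R2) ((m choose 2) + q * (m div 2))"
    by (intro packs_Un[OF packs1 packs2]) (simp add: region_disj)
  moreover have "?R1 \<union> ?R2 \<subseteq> E"
  proof -
    have "L i j" if "i < m + p" "j \<le> m" for i j
      using Lp[of "p - 1"] pq that down[of "m + (p - 1)" m i j] by auto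
    moreover have "L i j" if "i \<le> m" "j < m + q" for i j
      using Lq[of "q - 1"] pq that down[of m "m + (q - 1)" i j] by auto
    ultimately show ?thesis
      using pq by (intro Un_least clq_edges bip_edges_cross) auto
  qed
  moreover have "(base_left 0 \<union> base_right 0) \<inter> (?R1 \<union> ?R2) = {}"
    by (simp add: region_disj)
  ultimately obtain R where R: "packs R (2 * (m choose 2) + ((m choose 2) + q * (m div 2)))" "R \<subseteq> E"
    using base_extend[OF m(2) m(2)] by blast
  have "q * (m - p) + p * q = q * m"
    using pq by (simp add: diff_mult_distrib2 algebra_simps)
  then have "m + p * q \<le> q * m" using pq(5) by linarith
  moreover have "4 * c + (M + P) \<le> 2 * (2 * c + (c + X))"
    if "2 * X = Z" "2 * c + m = M" "m + P \<le> Z" for c M P X Z :: nat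
    using that by presburger
  ultimately have "4 * (m choose 2) + (m * m + p * q) \<le> 2 * (2 * (m choose 2) + ((m choose 2) + q * (m div 2)))"
    using half_mult by blast
  then show ?thesis
    using Lp Lq pq by (intro tuza_square[OF _ _ _ _ R, of p q]) auto
qed

lemma square_corner:
  assumes "L m m" "\<not> L (m + 1) m" "\<not> L m (m + 1)" "L 0 (m + 1) \<or> \<not> L (m + 1) 0"
  shows "tuza V E"
proof (cases "L 0 (m + 1)")
  case True
  \<comment> \<open>Index 0 is kept out of the apexes so that the edge from \<open>Inl 0\<close> to
    \<open>Inr 0\<close> is free for \<open>?T\<close>.\<close>
  let ?I = "{m} \<union> {1..<m - 1}"
  let ?R1 = "[Inr ` {..<m}]\<^bsup>2\<^esup> \<union> bip (Inl ` ?I) (Inr ` {..<m}) :: (nat + nat) set set"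
  let ?R2 = "[Inl ` {..<m}]\<^bsup>2\<^esup> \<union> bip (Inr ` {m}) (Inl ` {..<m}) :: (nat + nat) set set"
  let ?T = "bip {Inr 0} {Inr (m + 1)} \<union> bip {Inr (m + 1)} {Inl 0} \<union> bip {Inl 0} {Inr 0} :: (nat + nat) set set"
  have "card ?I = m - 1" using m_gt_1 by auto
  then have packs1: "packs ?R1 (m choose 2)" using m(2) by (intro rows_packs) auto
  have packs2: "packs ?R2 (m div 2)"
    using packs_clique[of "Inl ` {..<m}" "Inr ` {m}"] m m_gt_1 by (simp add: card_sum_image region_disj)
  have packs3: "packs ?T 1" by (intro packs_three_bip) auto
  have "packs (?R1 \<union> ?R2 \<union> ?T) ((m choose 2) + (m div 2) + 1)"
    using m(2) by (intro packs_Un[OF packs_Un[OF packs1 packs2] packs3]) (simp_all add: region_disj)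
  moreover have "?R1 \<union> ?R2 \<union> ?T \<subseteq> E"
  proof -
    have "?R1 \<union> ?R2 \<subseteq> E"
      using m(2) down[OF assms(1)] by (intro Un_least clq_edges bip_edges_cross) auto
    moreover have "bip {Inl 0} {Inr 0} \<subseteq> E"
      using m(2) down[OF assms(1)] bip_edges_cross(1)[of "{0}" "{0}" "2 * m" L] by auto
    moreover have "bip {Inr 0} {Inr (m + 1)} \<union> bip {Inr (m + 1)} {Inl 0} \<subseteq> E"
      using bip_edges_same(2)[of "{0}" "2 * m" "{m + 1}" L] bip_edges_cross(2)[of "{0}" "{m + 1}" "2 * m" L]
        True m_gt_1 by auto
    ultimately show ?thesis by blast
  qed
  moreover have "(base_left 0 \<union> base_right 0) \<inter> (?R1 \<union> ?R2 \<union> ?T) = {}"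
    using m_gt_1 by (simp add: region_disj)
  ultimately obtain R where R: "packs R (2 * (m choose 2) + ((m choose 2) + (m div 2) + 1))" "R \<subseteq> E"
    using base_extend[OF m(2) m(2)] by blast
  show ?thesis
  proof (rule tuza_square[OF _ _ _ _ R, of 1 1])
    show "i < 1" if "L (m + i) m" for i
      using down[OF that, of "m + 1" m] assms(2) by (cases i) auto
    show "j < 1" if "L m (m + j)" for j
      using down[OF that, of m "m + 1"] assms(3) by (cases j) auto
    have "4 * c + (M + 1 * 1) \<le> 2 * (2 * c + (c + X + 1))"
      if "2 * (1 * X) = 1 * m" "2 * c + m = M" for c M X :: nat
      using that by presburger
    then show "4 * (m choose 2) + (m * m + 1 * 1) \<le> 2 * (2 * (m choose 2) + ((m choose 2) + m div 2 + 1))"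
      using half_mult by blast
  qed (use m(2) in auto)
next
  case False
  then have no: "\<not> L 0 (m + 1)" "\<not> L (m + 1) 0" using assms(4) by auto
  have "L (m - 1) m" using down[OF assms(1)] by simp
  then obtain R where R: "packs R (2 * (m choose 2) + (m div 2 + (m choose 2)))" "R \<subseteq> E"
    using fan_packs by blast
  show ?thesis
  proof (rule tuza_balanced[OF R])
    let ?C = "{..<m} \<times> {m} \<union> {m} \<times> {..<m}"
    show "(i, j) \<in> ?C" if "L i j" "i \<in> {..<m} \<longleftrightarrow> j \<in> {m..<2*m}" "j < 2*m" for i j
    proof (cases "i < m")
      case True
      then show ?thesis using that down[OF that(1), of 0 "m + 1"] no by (cases "j = m") auto
    next
      case False
      then show ?thesis using that down[OF that(1), of "m + 1" 0] no by (cases "i = m") auto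
    qed
    have "card ?C \<le> 2 * m"
      by (intro order_trans[OF card_Un_le]) (simp add: card_cartesian_product)
    moreover have "2 * m \<le> m * m" using m_gt_1 by simp
    moreover have "4 * c + C \<le> 2 * (2 * c + (X + c))"
      if "2 * (1 * X) = 1 * m" "2 * c + m = M" "C \<le> M" for c C M X :: nat
      using that by presburger
    ultimately show "4 * (m choose 2) + card ?C \<le> 2 * (2 * (m choose 2) + (m div 2 + (m choose 2)))"
      using half_mult order_trans by blast
  qed auto
qed

text \<open>As in \<open>square_full\<close>, but without the last vertex of
  \<open>A\<^sub>2\<close>. Without \<open>?T\<close> twice the count is short by one; since edges
  inside \<open>A\<^sub>2\<close> are free, a triangle on two vertices of \<open>A\<^sub>2\<close>
  and \<open>Inr m\<close> closes the gap.\<close>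

lemma square_nearly_full:
  assumes Lp: "\<And>i. i < m \<Longrightarrow> L (m + i) m \<longleftrightarrow> i < m - 1" and Lq: "\<And>j. j < m \<Longrightarrow> L m (m + j) \<longleftrightarrow> j < m - 1"
    and "2 < m"
  shows "tuza V E"
proof -
  let ?A1 = "Inl ` {..<m} :: (nat + nat) set" and ?A2 = "Inl ` {m..<2*m - 1} :: (nat + nat) set"
  let ?T = "bip {Inl m} {Inl (m + 1)} \<union> bip {Inl (m + 1)} {Inr m} \<union> bip {Inr m} {Inl m} :: (nat + nat) set set"
  have packs1: "packs (bip ?A1 ?A2 \<union> bip (Inr ` {..<m}) (?A1 \<union> ?A2)) (m * (m - 1))"
    using packs_tripartite[of ?A1 ?A2 "Inr ` {..<m}"] by (simp add: card_sum_image region_disj)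
  have packs2: "packs ([?A1]\<^bsup>2\<^esup> \<union> bip (Inr ` {m..<2*m - 1}) ?A1) (m choose 2)"
    using packs_clique[of ?A1 "Inr ` {m..<2*m - 1}"] m by (simp add: card_sum_image region_disj choose_half)
  have packs3: "packs (base_right 0) (m choose 2)"
    using packs_clique[of "Inr ` {m..<2*m}" "Inr ` ({..<m} - {0})"] m
    by (simp add: card_sum_image choose_half region_disj)
  have packs4: "packs ?T 1" by (intro packs_three_bip) auto
  have L1: "L i j" if "i < 2*m - 1" "j \<le> m" for i j
    using Lp[of "m - 2"] assms(3) that down[of "m + (m - 2)" m i j] by auto
  have L2: "L i j" if "i \<le> m" "j < 2*m - 1" for i j
    using Lq[of "m - 2"] assms(3) that down[of m "m + (m - 2)" i j] by auto
  have "{..<m} \<union> {m..<2*m - 1} = {..<2*m - 1}" using m_gt_1 by auto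
  then have un: "?A1 \<union> ?A2 = Inl ` {..<2*m - 1}" by (metis image_Un)
  show ?thesis
  proof (rule tuza_square[where p = "m - 1" and q = "m - 1"])
    let ?R = "(bip ?A1 ?A2 \<union> bip (Inr ` {..<m}) (?A1 \<union> ?A2)) \<union> ([?A1]\<^bsup>2\<^esup> \<union> bip (Inr ` {m..<2*m - 1}) ?A1) \<union> base_right 0 \<union> ?T"
    show "packs ?R (m * (m - 1) + (m choose 2) + (m choose 2) + 1)"
      by (intro packs_Un[OF packs_Un[OF packs_Un[OF packs1 packs2] packs3] packs4]) (simp_all add: region_disj)
    have "?T \<subseteq> E"
      using bip_edges_same(1)[of "{m}" "2 * m" "{m + 1}" L] bip_edges_cross(1)[of "{m + 1}" "{m}" "2 * m" L]
        bip_edges_cross(2)[of "{m}" "{m}" "2 * m" L] L1 assms(3) by auto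
    moreover have "(bip ?A1 ?A2 \<union> bip (Inr ` {..<m}) (?A1 \<union> ?A2)) \<union> ([?A1]\<^bsup>2\<^esup> \<union> bip (Inr ` {m..<2*m - 1}) ?A1) \<union> base_right 0 \<subseteq> E"
      unfolding un using L1 L2 by (intro Un_least clq_edges bip_edges_same bip_edges_cross) auto
    ultimately show "?R \<subseteq> E" by blast
    obtain k where "m = Suc k" using m(2) by (cases m) auto
    then show "4 * (m choose 2) + (m * m + (m - 1) * (m - 1)) \<le> 2 * (m * (m - 1) + (m choose 2) + (m choose 2) + 1)"
      using two_choose[of k] by (simp add: algebra_simps)
  qed (use Lp Lq in auto)
qed

end

section \<open>Thresholds and the case distinction\<close>

lemma initial_segment:
  fixes Q :: "nat \<Rightarrow> bool"
  assumes "\<And>i j. Q j \<Longrightarrow> i \<le> j \<Longrightarrow> Q i" "\<not> Q b"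
  obtains p where "p \<le> b" "\<And>i. Q i \<longleftrightarrow> i < p"
proof
  show "(LEAST i. \<not> Q i) \<le> b" using assms(2) by (rule Least_le)
  show "Q i \<longleftrightarrow> i < (LEAST i. \<not> Q i)" for i
    using assms LeastI[of "\<lambda>i. \<not> Q i" b] not_less_Least[of i "\<lambda>i. \<not> Q i"] by (metis not_le)
qed

text \<open>This isolates the values for which neither orientation of \<open>square_wide\<close>
  applies. If \<open>p < q\<close>, then \<open>q * (m - p)\<close> already reaches
  \<open>m\<close>; for equal values \<open>p * (m - p)\<close> stays below \<open>m\<close> only at
  the two ends.\<close>

lemma balanced_corner:
  fixes p q m :: nat
  assumes pq: "0 < p" "p < m" "0 < q" "q < m" and "q * (m - p) < m" "p * (m - q) < m"
  shows "p = q \<and> (p = 1 \<or> p = m - 1)"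
proof -
  have less: False if "p < q" "q < m" "0 < p" "q * (m - p) < m" for p q :: nat
  proof -
    obtain d where d: "q = Suc (p + d)" using less_imp_Suc_add[OF \<open>p < q\<close>] by blast
    obtain e where e: "m = Suc (q + e)" using less_imp_Suc_add[OF \<open>q < m\<close>] by blast
    have "q * (m - p) = p * Suc (Suc (d + e)) + Suc d * Suc (Suc (d + e))"
      using d e by (simp add: algebra_simps)
    also have "\<dots> \<ge> p * 1 + 1 * Suc (Suc (d + e))"
      by (intro add_mono mult_le_mono) auto
    finally show False using that(4) d e by simp
  qed
  have "p = q" using less[of p q] less[of q p] assms by (meson linorder_neqE_nat)
  moreover have "p = 1 \<or> p = m - 1"
  proof (rule ccontr)
    assume "\<not> ?thesis"
    then have "2 \<le> p" "p + 2 \<le> m" using pq by linarith+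
    then obtain d e where de: "p = 2 + d" "m = p + 2 + e" using le_Suc_ex by meson
    then have "p * (m - p) = m + d + e + d * e" by (simp add: algebra_simps)
    then show False using assms(5) \<open>p = q\<close> by simp
  qed
  ultimately show ?thesis by blast
qed

lemma tuza_chain:
  assumes "cochain m L"
  shows "tuza (vertices (2 * m)) (edges (2 * m) L)"
proof -
  interpret cochain m L by fact
  interpret swap: cochain m "\<lambda>i j. L j i"
    by unfold_locales (use m down in auto)
  show ?thesis
  proof (cases "L m m")
    case False
    show ?thesis
    proof (cases "L (m - 1) m \<or> L m (m - 1)")
      case True
      then show ?thesis using False left_full tuza_swap[OF swap.left_full] by blast
    next
      case F: False
      obtain p where p: "p \<le> m - 1" "\<And>i. L i m \<longleftrightarrow> i < p"
        using initial_segment[of "\<lambda>i. L i m" "m - 1"] F down by blast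
      obtain q where q: "q \<le> m - 1" "\<And>j. L m j \<longleftrightarrow> j < q"
        using initial_segment[of "\<lambda>j. L m j" "m - 1"] F down by blast
      consider "p + q < m" "even q" | "p + q < m" "odd q" | "m \<le> p + q" "q \<le> p" | "m \<le> p + q" "p \<le> q"
        by linarith
      then show ?thesis
      proof cases
        case 1
        then show ?thesis using hook_even[OF p(2) q(2)] by blast
      next
        case 2
        then show ?thesis using hook_odd[OF p(2) q(2)] by blast
      next
        case 3
        then show ?thesis using hook_large[OF p(2) q(2)] p(1) m(2) by simp
      next
        case 4
        then have "tuza V (edges (2 * m) (\<lambda>i j. L j i))"
          using swap.hook_large[OF q(2) p(2)] q(1) m(2) by simp
        then show ?thesis by (rule tuza_swap)
      qed
    qed
  next
    case True
    have "i < m \<and> L (m + i) m" if "j < m \<and> L (m + j) m" "i \<le> j" for i j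
      using that down[of "m + j" m "m + i" m] by simp
    then obtain p where p: "p \<le> m" "\<And>i. (i < m \<and> L (m + i) m) \<longleftrightarrow> i < p"
      by (rule initial_segment[of "\<lambda>i. i < m \<and> L (m + i) m" m]) auto
    have "i < m \<and> L m (m + i)" if "j < m \<and> L m (m + j)" "i \<le> j" for i j
      using that down[of m "m + j" m "m + i"] by simp
    then obtain q where q: "q \<le> m" "\<And>j. (j < m \<and> L m (m + j)) \<longleftrightarrow> j < q"
      by (rule initial_segment[of "\<lambda>j. j < m \<and> L m (m + j)" m]) auto
    have pq0: "0 < p" "0 < q" using p(2)[of 0] q(2)[of 0] True m(2) by auto
    have Lp: "L (m + i) m \<longleftrightarrow> i < p" and Lq: "L m (m + i) \<longleftrightarrow> i < q" if "i < m" for i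
      using p(2)[of i] q(2)[of i] that by auto
    consider "p = m" | "q = m" | "p < m" "q < m" "m \<le> q * (m - p)" | "p < m" "q < m" "m \<le> p * (m - q)"
      | "p < m" "q < m" "q * (m - p) < m" "p * (m - q) < m"
      using p(1) q(1) le_neq_implies_less not_le by blast
    then show ?thesis
    proof cases
      case 1
      then show ?thesis using square_full[of q] Lp Lq pq0 q(1) by blast
    next
      case 2
      then have "tuza V (edges (2 * m) (\<lambda>i j. L j i))"
        using swap.square_full[of p] Lp Lq pq0 p(1) by blast
      then show ?thesis by (rule tuza_swap)
    next
      case 3
      then show ?thesis using square_wide[of p q] Lp Lq pq0 by blast
    next
      case 4
      then have "tuza V (edges (2 * m) (\<lambda>i j. L j i))"
        using swap.square_wide[of q p] Lp Lq pq0 by blast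
      then show ?thesis by (rule tuza_swap)
    next
      case 5
      then have eq: "p = q" "p = 1 \<or> p = m - 1" using balanced_corner pq0 by blast+
      show ?thesis
      proof (cases "p = 1")
        case one: True
        then have "\<not> L (m + 1) m" "\<not> L m (m + 1)" using Lp[of 1] Lq[of 1] eq m_gt_1 by auto
        then show ?thesis
          using square_corner tuza_swap[OF swap.square_corner] True by blast
      next
        \<comment> \<open>For \<open>m = 2\<close> the values 1 and \<open>m - 1\<close> coincide
          and belong to the previous case, so \<open>2 < m\<close> here.\<close>
        case False
        then have "2 < m" using eq pq0 by auto
        then show ?thesis using square_nearly_full Lp Lq eq False by auto
      qed
    qed
  qed
qed

section \<open>Transfer from a co-chain representation to the index model\<close>

lemma nbhd_chain:
  assumes "\<And>i. Suc i < n \<Longrightarrow> X (Suc i) \<subseteq> X i" "i' \<le> i" "i < n"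
  shows "(X i :: 'a set) \<subseteq> X i'"
  using assms(2,3) by (induction i rule: dec_induct) (use assms(1) Suc_lessD in blast)+

theorem theorem3:
  fixes V :: "'a set" and E :: "'a set set"
  assumes "even_balanced_cochain_graph V E"
  shows "\<tau> V E \<le> 2 * \<mu> V E"
proof (rule tuza_numbers)
  show graph: "finite_simple_graph V E" using assms by (simp add: even_balanced_cochain_graph_def)
  obtain K1 K2 where K: "cochain_representation V E K1 K2" "card K1 = card K2" "4 dvd card K1"
    using assms by (auto simp: even_balanced_cochain_graph_def)
  then have V: "K1 \<union> K2 = V" "K1 \<inter> K2 = {}" and cliques: "clique K1 E" "clique K2 E"
    by (auto simp: cochain_representation_def)
  obtain cs where cs: "distinct cs" "set cs = K1"
      "\<And>i. Suc i < length cs \<Longrightarrow> closed_nbhd E (cs ! Suc i) \<subseteq> closed_nbhd E (cs ! i)"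
    using K(1) by (auto simp: cochain_representation_def)
  obtain ds where ds: "distinct ds" "set ds = K2"
      "\<And>i. Suc i < length ds \<Longrightarrow> closed_nbhd E (ds ! i) \<subseteq> closed_nbhd E (ds ! Suc i)"
    using K(1) by (auto simp: cochain_representation_def)
  define n where "n = card K1"
  have len: "length cs = n" "length (rev ds) = n"
    using distinct_card[OF cs(1)] distinct_card[OF ds(1)] cs(2) ds(2) K(2) by (simp_all add: n_def)
  obtain k where k: "n = 2 * (2 * k)" using K(3) by (auto simp: n_def elim!: dvdE)
  show "tuza V E"
  proof (cases "k = 0")
    \<comment> \<open>The locale demands a positive \<open>m\<close>, so the empty graph is treated
      separately.\<close>
    case True
    then have "V = {}" using len k cs ds V by auto
    then have "triangles V E = {}" by (auto simp: triangles_def nsets_def)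
    then have "triangle_packing V E {}" "triangle_hitting V E {}"
      by (auto simp: triangle_packing_def triangle_hitting_def)
    then show ?thesis unfolding tuza_def by (metis card.empty finite.emptyI le0)
  next
    case False
    \<comment> \<open>Reversing \<open>ds\<close> makes neighbourhoods decrease along both lists, so
      adjacency becomes downward closed. \<open>L\<close> carries index bounds because list access
      beyond the length is unspecified.\<close>
    define a b where "a = (!) cs" and "b = (!) (rev ds)"
    define L where "L i j \<longleftrightarrow> i < n \<and> j < n \<and> {a i, b j} \<in> E" for i j
    have bij: "bij_betw a {..<n} K1" "bij_betw b {..<n} K2"
      using bij_betw_nth[of cs "{..<n}" K1] bij_betw_nth[of "rev ds" "{..<n}" K2] cs ds len
      by (auto simp: a_def b_def)
    then have in_K: "a i \<in> K1" "b i \<in> K2" if "i < n" for i using that by (auto simp: bij_betw_def)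
    have a_mono: "closed_nbhd E (a i) \<subseteq> closed_nbhd E (a i')" if "i' \<le> i" "i < n" for i i'
      using nbhd_chain[of n "\<lambda>i. closed_nbhd E (a i)"] cs(3) len that by (simp add: a_def)
    have "closed_nbhd E (b (Suc i)) \<subseteq> closed_nbhd E (b i)" if "Suc i < n" for i
      using ds(3)[of "n - Suc (Suc i)"] len that by (simp add: b_def rev_nth Suc_diff_Suc)
    then have b_mono: "closed_nbhd E (b j) \<subseteq> closed_nbhd E (b j')" if "j' \<le> j" "j < n" for j j'
      using nbhd_chain[of n "\<lambda>i. closed_nbhd E (b i)"] that by blast
    have "cochain (2 * k) L"
    proof
      fix i j i' j' assume L: "L i j" "i' \<le> i" "j' \<le> j"
      then have lt: "i < n" "j < n" "i' < n" "j' < n" by (auto simp: L_def)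
      have ne: "a x \<noteq> b y" if "x < n" "y < n" for x y
        using in_K(1)[OF that(1)] in_K(2)[OF that(2)] V(2) by auto
      \<comment> \<open>One index is lowered at a time, using symmetry of adjacency in between;
        \<open>ne\<close> excludes that membership in a closed neighbourhood comes from the vertex
        itself.\<close>
      have "b j \<in> closed_nbhd E (a i')" using a_mono[OF L(2)] L(1) lt by (auto simp: L_def closed_nbhd_def)
      then have "a i' \<in> closed_nbhd E (b j)" using ne lt by (fastforce simp: closed_nbhd_def insert_commute)
      then have "a i' \<in> closed_nbhd E (b j')" using b_mono[OF L(3)] lt by blast
      then show "L i' j'" using ne lt by (auto simp: closed_nbhd_def L_def insert_commute)
    qed (use False in auto)
    then have t: "tuza (vertices n) (edges n L)" using tuza_chain k by blast
    let ?f = "case_sum a b"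
    have inj: "inj_on ?f (vertices n)"
    proof (rule inj_onI)
      fix x y assume "x \<in> vertices n" "y \<in> vertices n" "?f x = ?f y"
      moreover have "a i \<noteq> b j" if "i < n" "j < n" for i j
        using in_K(1)[OF that(1)] in_K(2)[OF that(2)] V(2) by auto
      ultimately show "x = y"
        using bij by (cases x; cases y) (auto simp: vertices_def bij_betw_def dest: inj_onD, metis)
    qed
    have "(?f \<circ> Inl) ` {..<n} = K1" "(?f \<circ> Inr) ` {..<n} = K2" using bij by (auto simp: bij_betw_def)
    then have im: "?f ` Inl ` {..<n} = K1" "?f ` Inr ` {..<n} = K2" by (simp_all only: image_comp)
    then have fV: "?f ` vertices n = V" using V by (simp add: vertices_def image_Un)
    have "(`) ?f ` edges n L = [K1]\<^bsup>2\<^esup> \<union> [K2]\<^bsup>2\<^esup> \<union> {{a i, b j} | i j. i < n \<and> j < n \<and> L i j}"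
    proof -
      have "inj_on ?f (Inl ` {..<n})" "inj_on ?f (Inr ` {..<n})"
        using inj by (auto simp: vertices_def inj_on_Un)
      then have "(`) ?f ` [Inl ` {..<n}]\<^bsup>2\<^esup> = [K1]\<^bsup>2\<^esup>" "(`) ?f ` [Inr ` {..<n}]\<^bsup>2\<^esup> = [K2]\<^bsup>2\<^esup>"
        using im by (simp_all add: nsets_image[symmetric])
      moreover have "(`) ?f ` {{Inl i, Inr j} | i j. i < n \<and> j < n \<and> L i j} = {?f ` {Inl i, Inr j} | i j. i < n \<and> j < n \<and> L i j}"
        by blast
      ultimately show ?thesis by (simp add: edges_def image_Un)
    qed
    also have "\<dots> = E"
    proof (intro equalityI subsetI)
      fix e assume "e \<in> [K1]\<^bsup>2\<^esup> \<union> [K2]\<^bsup>2\<^esup> \<union> {{a i, b j} | i j. i < n \<and> j < n \<and> L i j}"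
      then show "e \<in> E" using cliques by (auto simp: clique_def L_def elim!: nsets2_E)
    next
      fix e assume e: "e \<in> E"
      then obtain x y where xy: "e = {x, y}" "x \<in> V" "y \<in> V" "x \<noteq> y"
        using graph by (auto simp: finite_simple_graph_def elim!: nsets2_E)
      have cross: "{u, v} \<in> {{a i, b j} | i j. i < n \<and> j < n \<and> L i j}" if "u \<in> K1" "v \<in> K2" "{u, v} \<in> E" for u v
      proof -
        obtain i j where "i < n" "u = a i" "j < n" "v = b j"
          using bij \<open>u \<in> K1\<close> \<open>v \<in> K2\<close> by (auto simp: bij_betw_def)
        then show ?thesis using that by (auto simp: L_def)
      qed
      show "e \<in> [K1]\<^bsup>2\<^esup> \<union> [K2]\<^bsup>2\<^esup> \<union> {{a i, b j} | i j. i < n \<and> j < n \<and> L i j}"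
        using xy e V(1) cross[of x y] cross[of y x] by (auto simp: insert_commute)
    qed
    finally show ?thesis using tuza_image[OF inj edges_vertices t] fV by simp
  qed
qed

end
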